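(* Let $R$ be a $v$-domain. The following assertions are equivalent: (1) $R$ is a strongly $t$-discrete Boole $t$-regular domain; (2) $R$ is a strongly $t$-discrete GCD domain of finite $t$-character; (3) $R$ is a strongly $t$-stable domain.
   Context: All rings are integral domains (commutative with identity). Let $R$ be a domain with quotient field $K$. For nonzero fractional ideals (more generally, nonzero $R$-submodules of $K$) $I,J$, put $(I:J)=\{x\in K\mid xJ\subseteq I\}$, $I^{-1}=(R:I)$, $I_v=(I^{-1})^{-1}$, and $I_t=\bigcup J_v$, where $J$ ranges over the nonzero finitely generated subideals of $I$. A nonzero fractional ideal $I$ is a (fractional) $t$-ideal if $I_t=I$. A $t$-prime ideal is a (nonzero) prime ideal of $R$ that is a $t$-ideal. A $t$-maximal ideal is an ideal that is maximal among the proper integral $t$-ideals of $R$. - $R$ is a $v$-domain if $(I_v:I_v)=R$ for each nonzero finitely generated ideal $I$ of $R$. - The $t$-class semigroup $S_t(R)$ is the semigroup of fractional $t$-ideals of $R$, with multiplication $(I,J)\mapsto (IJ)_t$, modulo its subsemigroup of nonzero principal fractional ideals (so $I$ and $J$ have the same class iff $I=cJ$ for some $0\neq c\in K$). $R$ is Boole $t$-regular if $S_t(R)$ is a Boolean semigroup, i.e. $x^2=x$ for all $x\in S_t(R)$; equivalently, for every fractional $t$-ideal $I$ of $R$ there is $0\ne c\in K$ with $(I^2)_t=cI$. - $R$ is strongly $t$-discrete if it has no $t$-idempotent $t$-prime ideals, i.e. $(P^2)_t\subsetneq P$ for every $t$-prime ideal $P$ of $R$. - $R$ is a GCD domain if every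 pair of nonzero elements of $R$ has a greatest common divisor; equivalently, $I_t$ is principal for every nonzero finitely generated fractional ideal $I$ of $R$. - $R$ is of finite $t$-character if each proper (nonzero, integral) $t$-ideal of $R$ is contained in only finitely many $t$-maximal ideals of $R$. - $R$ is strongly $t$-stable if each $t$-ideal $I$ of $R$ is principal in its endomorphism ring $(I:I)$, i.e. $I=c(I:I)$ for some $c\in I$. *)

theory Defs
  imports Complex_Main
begin

text \<open>
  A domain with its quotient field \<open>K\<close> is represented by a type \<open>'k\<close> of class \<^class>\<open>field\<close> (this is \<open>K\<close>)
  and a subset \<open>R\<close> of \<open>'k\<close> that is a unital subring of which \<open>'k\<close> is the field of fractions.  All
  ideals, fractional ideals and overrings of \<open>R\<close> are then subsets of \<open>'k\<close>.
\<close>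

definition domain_with_quotient_field :: "'k::field set \<Rightarrow> bool" where
  "domain_with_quotient_field R \<longleftrightarrow>
     1 \<in> R \<and> (\<forall>x\<in>R. \<forall>y\<in>R. x - y \<in> R \<and> x * y \<in> R) \<and>
     (\<forall>x. \<exists>a\<in>R. \<exists>b\<in>R. b \<noteq> 0 \<and> x = a / b)"

definition submodule :: "'k::field set \<Rightarrow> 'k set \<Rightarrow> bool" where
  "submodule R I \<longleftrightarrow>
     0 \<in> I \<and> (\<forall>x\<in>I. \<forall>y\<in>I. x + y \<in> I) \<and> (\<forall>r\<in>R. \<forall>x\<in>I. r * x \<in> I)"

definition fg_submodule :: "'k::field set \<Rightarrow> 'k set \<Rightarrow> bool" where
  "fg_submodule R I \<longleftrightarrow> (\<exists>S. finite S \<and> I = submodule R hull S)"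

definition ideal_product :: "'k::field set \<Rightarrow> 'k set \<Rightarrow> 'k set \<Rightarrow> 'k set" where
  "ideal_product R I J = submodule R hull {x * y | x y. x \<in> I \<and> y \<in> J}"

definition scaled :: "'k::field \<Rightarrow> 'k set \<Rightarrow> 'k set" where
  "scaled c I = (\<lambda>x. c * x) ` I"

definition colon :: "'k::field set \<Rightarrow> 'k set \<Rightarrow> 'k set" where
  "colon I J = {x. \<forall>y\<in>J. x * y \<in> I}"

definition v_closure :: "'k::field set \<Rightarrow> 'k set \<Rightarrow> 'k set" where
  "v_closure R I = colon R (colon R I)"

definition t_closure :: "'k::field set \<Rightarrow> 'k set \<Rightarrow> 'k set" where
  "t_closure R I = \<Union> {v_closure R J | J. fg_submodule R J \<and> J \<noteq> {0} \<and> J \<subseteq> I}"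

text \<open>Fractional ideals and (fractional) t-ideals are nonzero by definition.\<close>

definition fractional_ideal :: "'k::field set \<Rightarrow> 'k set \<Rightarrow> bool" where
  "fractional_ideal R I \<longleftrightarrow>
     submodule R I \<and> I \<noteq> {0} \<and> (\<exists>d\<in>R. d \<noteq> 0 \<and> scaled d I \<subseteq> R)"

definition t_ideal :: "'k::field set \<Rightarrow> 'k set \<Rightarrow> bool" where
  "t_ideal R I \<longleftrightarrow> fractional_ideal R I \<and> t_closure R I = I"

definition t_prime :: "'k::field set \<Rightarrow> 'k set \<Rightarrow> bool" where
  "t_prime R P \<longleftrightarrow>
     t_ideal R P \<and> P \<subset> R \<and> (\<forall>a\<in>R. \<forall>b\<in>R. a * b \<in> P \<longrightarrow> a \<in> P \<or> b \<in> P)"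

definition t_maximal :: "'k::field set \<Rightarrow> 'k set \<Rightarrow> bool" where
  "t_maximal R M \<longleftrightarrow>
     t_ideal R M \<and> M \<subset> R \<and> (\<forall>N. t_ideal R N \<and> N \<subset> R \<and> M \<subseteq> N \<longrightarrow> N = M)"

definition v_domain :: "'k::field set \<Rightarrow> bool" where
  "v_domain R \<longleftrightarrow>
     (\<forall>I. fg_submodule R I \<and> I \<noteq> {0} \<and> I \<subseteq> R \<longrightarrow> colon (v_closure R I) (v_closure R I) = R)"

text \<open>
  The t-class semigroup: its elements are the classes of fractional t-ideals modulo the nonzero
  principal ones, with the multiplication induced by \<open>(I, J) \<mapsto> (IJ)\<^sub>t\<close>.
\<close>

definition t_class_rel :: "'k::field set \<Rightarrow> ('k set \<times> 'k set) set" where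
  "t_class_rel R = {(I, J). t_ideal R I \<and> t_ideal R J \<and> (\<exists>c. c \<noteq> 0 \<and> I = scaled c J)}"

definition t_class_semigroup :: "'k::field set \<Rightarrow> 'k set set set" where
  "t_class_semigroup R = {I. t_ideal R I} // t_class_rel R"

definition t_class_mult :: "'k::field set \<Rightarrow> 'k set set \<Rightarrow> 'k set set \<Rightarrow> 'k set set" where
  "t_class_mult R X Y =
     (\<Union>I\<in>X. \<Union>J\<in>Y. t_class_rel R `` {t_closure R (ideal_product R I J)})"

definition boole_t_regular :: "'k::field set \<Rightarrow> bool" where
  "boole_t_regular R \<longleftrightarrow> (\<forall>X\<in>t_class_semigroup R. t_class_mult R X X = X)"

definition strongly_t_discrete :: "'k::field set \<Rightarrow> bool" where
  "strongly_t_discrete R \<longleftrightarrow>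
     (\<forall>P. t_prime R P \<longrightarrow> t_closure R (ideal_product R P P) \<subset> P)"

text \<open>Divisibility has to be relativised to \<open>R\<close>, since \<^term>\<open>(dvd)\<close> on \<open>'k\<close> is divisibility in a field.\<close>

definition divides_in :: "'k::field set \<Rightarrow> 'k \<Rightarrow> 'k \<Rightarrow> bool" where
  "divides_in R a b \<longleftrightarrow> (\<exists>c\<in>R. b = a * c)"

definition gcd_domain :: "'k::field set \<Rightarrow> bool" where
  "gcd_domain R \<longleftrightarrow>
     (\<forall>a\<in>R. \<forall>b\<in>R. a \<noteq> 0 \<and> b \<noteq> 0 \<longrightarrow>
        (\<exists>d\<in>R. divides_in R d a \<and> divides_in R d b \<and>
           (\<forall>e\<in>R. divides_in R e a \<and> divides_in R e b \<longrightarrow> divides_in R e d)))"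

definition finite_t_character :: "'k::field set \<Rightarrow> bool" where
  "finite_t_character R \<longleftrightarrow>
     (\<forall>I. t_ideal R I \<and> I \<subset> R \<longrightarrow> finite {M. t_maximal R M \<and> I \<subseteq> M})"

definition strongly_t_stable :: "'k::field set \<Rightarrow> bool" where
  "strongly_t_stable R \<longleftrightarrow> (\<forall>I. t_ideal R I \<longrightarrow> (\<exists>c\<in>I. I = scaled c (colon I I)))"

end

theory Submission
  imports Defs
begin

text \<open>
  Boole \<open>t\<close>-regularity and strong \<open>t\<close>-stability both force \<open>R\<close> to be a GCD domain, and this is where the
  \<open>v\<close>-domain hypothesis enters.  For \<open>J = {a, b}\<^sub>v\<close> one has \<open>(J : J) = R\<close>, so a generator of \<open>J\<close> over \<open>(J : J)\<close> generates it over
  \<open>R\<close>, and so does any \<open>c\<close> with \<open>(J\<^sup>2)\<^sub>t = c J\<close>; a generator of \<open>J\<close> is a gcd of \<open>a\<close> and \<open>b\<close>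
  (lemmas \<open>strongly_t_stable_imp_gcd_domain\<close>, \<open>boole_t_regular_imp_gcd_domain\<close>).

  In a GCD domain the theory becomes elementary.  Any two elements of the quotient field have a gcd
  for the divisibility relation with quotients in \<open>R\<close>, the \<open>v\<close>-closure of a finite set consists of the
  multiples of its gcd, and so the \<open>t\<close>-ideals are the fractional ideals closed under gcds
  (\<open>t_ideal_iff\<close>).  For a \<open>t\<close>-ideal \<open>I\<close>, an element lies in \<open>(I\<^sup>2)\<^sub>t\<close> iff it is a multiple
  of the square of an element of \<open>I\<close> (\<open>t_closure_square\<close>).  Granted this description, the implications hold for the following reasons.

  \<^item> Boole regularity implies stability: if \<open>(I\<^sup>2)\<^sub>t = c I\<close>, then \<open>J = c\<^sup>-\<^sup>1 I\<close> is \<open>t\<close>-idempotent,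
    and \<open>I = c (I : I)\<close> as soon as \<open>1 \<in> J\<close>.  If \<open>1 \<notin> J\<close>, then \<open>J \<inter> R\<close> is a proper \<open>t\<close>-idempotent
    \<open>t\<close>-ideal of \<open>R\<close>, and its minimal primes are \<open>t\<close>-idempotent \<open>t\<close>-primes, against strong
    \<open>t\<close>-discreteness (\<open>square_divisible_t_prime_exists\<close>).

  \<^item> Stability implies Boole regularity and discreteness: if \<open>I = c (I : I)\<close>, then \<open>I\<^sup>2 = c I\<close>; for a
    \<open>t\<close>-idempotent \<open>t\<close>-prime this would make \<open>c\<close> a unit of \<open>(I : I)\<close> and put \<open>1\<close> into the prime.

  \<^item> Stability implies finite \<open>t\<close>-character: if a nonzero \<open>a\<close> lies in infinitely many \<open>t\<close>-maximal
    ideals, then coprime factors split off \<open>a\<close> one after the other (\<open>coprime_factor_step\<close>), giving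
    products \<open>p\<^sub>n\<close> of pairwise coprime nonunits with \<open>p\<^sub>n\<close> dividing \<open>a\<close>.  The \<open>t\<close>-ideal generated by all
    \<open>a / p\<^sub>n\<close> is not principal over its endomorphism ring (\<open>no_infinite_coprime_factorization\<close>).

  \<^item> Finite \<open>t\<close>-character implies stability: locally at a \<open>t\<close>-maximal ideal a GCD domain is a
    valuation domain, and strong \<open>t\<close>-discreteness produces a local generator over the endomorphism
    ring (\<open>local_generator\<close>).  Every divisor in \<open>I\<close> of a local generator is again one, so the gcd of
    finitely many local generators works everywhere (\<open>integral_generator\<close>).
\<close>

section \<open>Divisibility, submodules and colons\<close>

locale quotient_field_domain =
  fixes R :: "'k::field set"
  assumes domain: "domain_with_quotient_field R"
begin

abbreviation divides :: "'k \<Rightarrow> 'k \<Rightarrow> bool"  (infix "\<unlhd>" 50)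
  where "a \<unlhd> b \<equiv> divides_in R a b"

lemma one_in [simp]: "1 \<in> R"
  and diff_in: "x \<in> R \<Longrightarrow> y \<in> R \<Longrightarrow> x - y \<in> R"
  and mult_in: "x \<in> R \<Longrightarrow> y \<in> R \<Longrightarrow> x * y \<in> R"
  using domain by (auto simp: domain_with_quotient_field_def)

lemma zero_in [simp]: "0 \<in> R"
  using diff_in[OF one_in one_in] by simp

lemma add_in: "x \<in> R \<Longrightarrow> y \<in> R \<Longrightarrow> x + y \<in> R"
  using diff_in[of x "0 - y"] diff_in[of 0 y] by simp

lemma power_in: "x \<in> R \<Longrightarrow> x ^ n \<in> R"
  by (induction n) (auto intro: mult_in)

lemma fraction_cases:
  obtains a b where "a \<in> R" "b \<in> R" "b \<noteq> 0" "x = a / b"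
  using domain unfolding domain_with_quotient_field_def by blast

lemma divides_iff: "a \<noteq> 0 \<Longrightarrow> a \<unlhd> b \<longleftrightarrow> b / a \<in> R"
  by (auto simp: divides_in_def intro: bexI[of _ "b / a"])

lemma divides_one_left [simp]: "1 \<unlhd> b \<longleftrightarrow> b \<in> R"
  by (simp add: divides_iff)

lemma divides_refl [simp]: "a \<unlhd> a"
  by (auto simp: divides_in_def intro: bexI[of _ 1])

lemma divides_zero [simp]: "a \<unlhd> 0"
  by (auto simp: divides_in_def intro: bexI[of _ 0])

lemma zero_divides [simp]: "0 \<unlhd> a \<longleftrightarrow> a = 0"
  by (auto simp: divides_in_def intro: one_in)

lemma divides_trans: "a \<unlhd> b \<Longrightarrow> b \<unlhd> c \<Longrightarrow> a \<unlhd> c"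
  unfolding divides_in_def by (metis mult.assoc mult_in)

lemma divides_add: "a \<unlhd> b \<Longrightarrow> a \<unlhd> c \<Longrightarrow> a \<unlhd> b + c"
  unfolding divides_in_def by (metis add_in distrib_left)

lemma divides_mult: "a \<unlhd> b \<Longrightarrow> c \<unlhd> d \<Longrightarrow> a * c \<unlhd> b * d"
  unfolding divides_in_def by (smt (verit) mult.assoc mult.left_commute mult_in)

lemma divides_power: "a \<unlhd> b \<Longrightarrow> a ^ n \<unlhd> b ^ n"
  by (induction n) (auto intro: divides_mult)

lemma divides_mult_right: "a \<unlhd> b \<Longrightarrow> c \<in> R \<Longrightarrow> a \<unlhd> b * c"
  unfolding divides_in_def by (metis mult.assoc mult_in)

lemma divides_mult_cancel: "c \<noteq> 0 \<Longrightarrow> c * a \<unlhd> c * b \<longleftrightarrow> a \<unlhd> b"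
  by (auto simp: divides_in_def)

lemma divides_in_R: "a \<in> R \<Longrightarrow> a \<unlhd> b \<Longrightarrow> b \<in> R"
  using divides_trans[of 1 a b] by simp

lemma submoduleD:
  assumes "submodule R I"
  shows "0 \<in> I" "x \<in> I \<Longrightarrow> y \<in> I \<Longrightarrow> x + y \<in> I" "r \<in> R \<Longrightarrow> x \<in> I \<Longrightarrow> r * x \<in> I"
  using assms by (auto simp: submodule_def)

lemma submodule_divides: "submodule R I \<Longrightarrow> x \<in> I \<Longrightarrow> x \<unlhd> y \<Longrightarrow> y \<in> I"
  by (auto simp: submodule_def divides_in_def mult.commute)

lemma submodule_hull: "submodule R (submodule R hull S)"
  by (rule hull_in) (auto simp: submodule_def)

lemma submodule_colon: "submodule R I \<Longrightarrow> submodule R (colon I J)"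
  by (auto simp: submodule_def colon_def distrib_right mult.assoc)

lemma submodule_R: "submodule R R"
  by (auto simp: submodule_def intro: add_in mult_in)

lemma hull_le: "S \<subseteq> I \<Longrightarrow> submodule R I \<Longrightarrow> submodule R hull S \<subseteq> I"
  by (rule hull_minimal)

lemma scaled_iff: "c \<noteq> 0 \<Longrightarrow> x \<in> scaled c I \<longleftrightarrow> x / c \<in> I"
  by (force simp: scaled_def)

lemma submodule_scaled: "submodule R I \<Longrightarrow> submodule R (scaled c I)"
  unfolding submodule_def scaled_def image_iff
  by (safe; metis mult_zero_right distrib_left mult.left_commute)

lemma scaled_scaled [simp]: "scaled c (scaled d I) = scaled (c * d) I"
  by (auto simp: scaled_def image_image mult.assoc)

lemma scaled_one [simp]: "scaled 1 I = I"
  by (simp add: scaled_def)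

lemma scaled_mono: "I \<subseteq> J \<Longrightarrow> scaled c I \<subseteq> scaled c J"
  by (auto simp: scaled_def)

lemma hull_scaled:
  assumes "c \<noteq> 0"
  shows "submodule R hull (scaled c S) = scaled c (submodule R hull S)"
proof -
  have sub: "submodule R hull (scaled c S) \<subseteq> scaled c (submodule R hull S)" for c S
    by (intro hull_le submodule_scaled submodule_hull scaled_mono hull_subset)
  have "scaled c (submodule R hull S) \<subseteq> scaled c (scaled (inverse c) (submodule R hull (scaled c S)))"
    using sub[of "inverse c" "scaled c S"] assms by (intro scaled_mono) simp
  with sub assms show ?thesis by auto
qed

lemma colon_antimono: "I \<subseteq> J \<Longrightarrow> colon K J \<subseteq> colon K I"
  by (auto simp: colon_def)

lemma colon_hull: "submodule R I \<Longrightarrow> colon I (submodule R hull S) = colon I S"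
proof
  assume I: "submodule R I"
  show "colon I S \<subseteq> colon I (submodule R hull S)"
  proof
    fix x assume x: "x \<in> colon I S"
    have "submodule R {y. x * y \<in> I}"
      using I by (auto simp: submodule_def distrib_left mult.left_commute)
    then have "submodule R hull S \<subseteq> {y. x * y \<in> I}"
      using x by (intro hull_le) (auto simp: colon_def)
    then show "x \<in> colon I (submodule R hull S)" by (auto simp: colon_def)
  qed
  show "colon I (submodule R hull S) \<subseteq> colon I S"
    by (intro colon_antimono hull_subset)
qed

lemma colon_scaled: "c \<noteq> 0 \<Longrightarrow> colon I (scaled c J) = scaled (inverse c) (colon I J)"
  by (auto simp: scaled_iff colon_def) (auto simp: scaled_def field_simps)

section \<open>The \<open>v\<close>- and \<open>t\<close>-closures\<close>

lemma subset_v_closure: "I \<subseteq> v_closure R I"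
  by (auto simp: v_closure_def colon_def mult.commute)

lemma v_closure_mono: "I \<subseteq> J \<Longrightarrow> v_closure R I \<subseteq> v_closure R J"
  unfolding v_closure_def by (intro colon_antimono)

lemma colon_v_closure: "colon R (v_closure R I) = colon R I"
  using subset_v_closure[of "colon R I"] colon_antimono[OF subset_v_closure]
  unfolding v_closure_def by blast

lemma v_closure_idem: "v_closure R (v_closure R I) = v_closure R I"
  by (metis colon_v_closure v_closure_def)

lemma submodule_v_closure: "submodule R (v_closure R I)"
  unfolding v_closure_def by (intro submodule_colon submodule_R)

lemma v_closure_hull: "v_closure R (submodule R hull S) = v_closure R S"
  by (simp add: v_closure_def colon_hull submodule_R)

lemma v_closure_scaled: "c \<noteq> 0 \<Longrightarrow> v_closure R (scaled c I) = scaled c (v_closure R I)"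
  by (simp add: v_closure_def colon_scaled)

lemma hull_nonzero: "S \<noteq> {} \<Longrightarrow> S \<noteq> {0} \<Longrightarrow> submodule R hull S \<noteq> {0}"
  using hull_subset[of S "submodule R"] by (metis subset_singletonD)

text \<open>
  The \<open>t\<close>-closure is defined through finitely generated submodules; since \<open>v\<close>-closures ignore the passage
  from a generating set to its hull, finite subsets serve as well.
\<close>

lemma t_closureI:
  assumes "finite S" "S \<subseteq> I" "submodule R I" "x \<in> v_closure R S" "\<exists>s\<in>S. s \<noteq> 0"
  shows "x \<in> t_closure R I"
proof -
  have "fg_submodule R (submodule R hull S)" using assms(1) by (auto simp: fg_submodule_def)
  moreover have "submodule R hull S \<noteq> {0}" using assms(5) by (intro hull_nonzero) auto
  moreover have "submodule R hull S \<subseteq> I" using assms by (intro hull_le)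
  moreover have "x \<in> v_closure R (submodule R hull S)" using assms(4) by (simp add: v_closure_hull)
  ultimately show ?thesis unfolding t_closure_def by blast
qed

lemma t_closureE:
  assumes "x \<in> t_closure R I"
  obtains S where "finite S" "S \<subseteq> I" "x \<in> v_closure R S" "\<exists>s\<in>S. s \<noteq> 0"
proof -
  obtain S where S: "finite S" "x \<in> v_closure R (submodule R hull S)"
      "submodule R hull S \<noteq> {0}" "submodule R hull S \<subseteq> I"
    using assms by (auto simp: t_closure_def fg_submodule_def)
  have "\<exists>s\<in>S. s \<noteq> 0"
  proof (rule ccontr)
    assume "\<not> ?thesis"
    then have "S \<subseteq> {0}" by auto
    then have "submodule R hull S \<subseteq> {0}" by (intro hull_le) (auto simp: submodule_def)
    with S(3) submodule_hull[of S] show False by (auto simp: submodule_def)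
  qed
  moreover have "S \<subseteq> I" using S(4) hull_subset[of S "submodule R"] by blast
  ultimately show thesis using S that[of S] by (simp add: v_closure_hull)
qed

text \<open>
  The zero ideal is excluded because its \<open>t\<close>-closure is empty.  A zero element of \<open>I\<close> is captured
  together with a nonzero companion.
\<close>

lemma subset_t_closure:
  assumes "submodule R I" "I \<noteq> {0}"
  shows "I \<subseteq> t_closure R I"
proof
  fix x assume x: "x \<in> I"
  obtain y where y: "y \<in> I" "y \<noteq> 0" using assms submoduleD(1) by fastforce
  have "x \<in> v_closure R {x, y}" using subset_v_closure by blast
  then show "x \<in> t_closure R I" using x y assms by (intro t_closureI[of "{x, y}"]) auto
qed

lemma t_closure_mono: "I \<subseteq> J \<Longrightarrow> t_closure R I \<subseteq> t_closure R J"
  unfolding t_closure_def by blast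

lemma t_closure_le_v_closure: "t_closure R I \<subseteq> v_closure R I"
  by (meson subsetI subsetD t_closureE v_closure_mono)

lemma t_closure_scaled:
  assumes "c \<noteq> 0" and I: "submodule R I"
  shows "t_closure R (scaled c I) = scaled c (t_closure R I)"
proof -
  have sub: "scaled c (t_closure R I) \<subseteq> t_closure R (scaled c I)"
    if "c \<noteq> 0" "submodule R I" for c I
  proof
    fix x assume "x \<in> scaled c (t_closure R I)"
    then have "x / c \<in> t_closure R I" using that by (simp add: scaled_iff)
    then obtain S where S: "finite S" "S \<subseteq> I" "x / c \<in> v_closure R S" "\<exists>s\<in>S. s \<noteq> 0"
      by (rule t_closureE)
    have "x \<in> v_closure R (scaled c S)" using S that by (simp add: v_closure_scaled scaled_iff)
    then show "x \<in> t_closure R (scaled c I)" using S that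
      by (intro t_closureI[of "scaled c S"] scaled_mono submodule_scaled) (auto simp: scaled_def)
  qed
  have "scaled c (scaled (inverse c) (t_closure R (scaled c I))) \<subseteq> scaled c (t_closure R I)"
    using sub[of "inverse c" "scaled c I"] assms by (intro scaled_mono) (simp add: submodule_scaled)
  with sub assms show ?thesis by auto
qed

lemma fractional_idealI:
  assumes "submodule R I" "x \<in> I" "x \<noteq> 0" "d \<in> R" "d \<noteq> 0" "\<And>y. y \<in> I \<Longrightarrow> d * y \<in> R"
  shows "fractional_ideal R I"
  using assms by (auto simp: fractional_ideal_def scaled_def)

lemma fractional_idealE:
  assumes "fractional_ideal R I"
  obtains x d where "submodule R I" "x \<in> I" "x \<noteq> 0" "d \<in> R" "d \<noteq> 0" "\<forall>y\<in>I. d * y \<in> R"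
proof -
  from assms obtain d where "submodule R I" "I \<noteq> {0}" "d \<in> R" "d \<noteq> 0" "\<forall>y\<in>I. d * y \<in> R"
    by (auto simp: fractional_ideal_def scaled_def)
  moreover then obtain x where "x \<in> I" "x \<noteq> 0" using submoduleD(1) by fastforce
  ultimately show thesis using that by blast
qed

lemma fractional_ideal_scaled:
  assumes "fractional_ideal R I" "c \<noteq> 0"
  shows "fractional_ideal R (scaled c I)"
proof -
  obtain x d where I: "submodule R I" "x \<in> I" "x \<noteq> 0" "d \<in> R" "d \<noteq> 0" "\<forall>y\<in>I. d * y \<in> R"
    using assms(1) by (rule fractional_idealE)
  obtain p q where pq: "p \<in> R" "q \<in> R" "q \<noteq> 0" "c = p / q" by (rule fraction_cases)
  show ?thesis
  proof (rule fractional_idealI[of _ "c * x" "d * q"])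
    show "d * q * y \<in> R" if "y \<in> scaled c I" for y
    proof -
      obtain z where z: "z \<in> I" "y = p / q * z" using \<open>y \<in> scaled c I\<close> pq(4) unfolding scaled_def by blast
      then show ?thesis using mult_in[OF pq(1) bspec[OF I(6) z(1)]] pq(3) by (simp add: mult_ac)
    qed
  qed (use I pq(2,3) assms(2) mult_in submodule_scaled in \<open>auto simp: scaled_iff\<close>)
qed

lemma fractional_ideal_t_closure:
  assumes "fractional_ideal R I"
  shows "fractional_ideal R (t_closure R I)"
proof -
  obtain x d where I: "submodule R I" "x \<in> I" "x \<noteq> 0" "d \<in> R" "d \<noteq> 0" "\<forall>y\<in>I. d * y \<in> R"
    using assms by (rule fractional_idealE)
  have sub: "I \<subseteq> t_closure R I" using I by (intro subset_t_closure) auto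
  show ?thesis
  proof (rule fractional_idealI[of _ x d])
    show "submodule R (t_closure R I)"
      unfolding submodule_def
    proof (intro conjI ballI)
      show "0 \<in> t_closure R I" using sub I submoduleD by blast
    next
      fix y z assume "y \<in> t_closure R I" "z \<in> t_closure R I"
      then obtain S T where ST: "finite S" "S \<subseteq> I" "y \<in> v_closure R S" "\<exists>s\<in>S. s \<noteq> 0"
        "finite T" "T \<subseteq> I" "z \<in> v_closure R T" by (meson t_closureE)
      have "y \<in> v_closure R (S \<union> T)" "z \<in> v_closure R (S \<union> T)"
        using ST v_closure_mono[of S "S \<union> T"] v_closure_mono[of T "S \<union> T"] by auto
      then have "y + z \<in> v_closure R (S \<union> T)" using submodule_v_closure submoduleD by blast
      then show "y + z \<in> t_closure R I" using ST I by (intro t_closureI[of "S \<union> T"]) auto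
    next
      fix r y assume r: "r \<in> R" and "y \<in> t_closure R I"
      then obtain S where S: "finite S" "S \<subseteq> I" "y \<in> v_closure R S" "\<exists>s\<in>S. s \<noteq> 0"
        by (meson t_closureE)
      then have "r * y \<in> v_closure R S" using r submodule_v_closure submoduleD by blast
      then show "r * y \<in> t_closure R I" using S I by (intro t_closureI[of S]) auto
    qed
    show "d * y \<in> R" if "y \<in> t_closure R I" for y
    proof -
      from that obtain S where S: "S \<subseteq> I" "y \<in> v_closure R S" by (meson t_closureE)
      then have "d \<in> colon R S" using I by (auto simp: colon_def)
      then show ?thesis using S by (auto simp: v_closure_def colon_def mult.commute)
    qed
  qed (use I sub in auto)
qed

text \<open>
  Directedness: finitely many elements of \<open>I\<^sub>t\<close>, each in the \<open>v\<close>-closure of its own finite subset of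
  \<open>I\<close>, all lie in the \<open>v\<close>-closure of the union of these subsets.  This makes the \<open>t\<close>-closure idempotent.
\<close>

lemma finite_subset_t_closure:
  assumes "finite T" "T \<subseteq> t_closure R I" "I \<noteq> {0}" "submodule R I"
  shows "\<exists>S. finite S \<and> S \<subseteq> I \<and> (\<exists>s\<in>S. s \<noteq> 0) \<and> T \<subseteq> v_closure R S"
  using assms(1,2)
proof (induction T)
  case empty
  obtain x where "x \<in> I" "x \<noteq> 0" using assms submoduleD(1) by fastforce
  then show ?case by (intro exI[of _ "{x}"]) auto
next
  case (insert t T)
  then obtain S S' where S: "finite S" "S \<subseteq> I" "\<exists>s\<in>S. s \<noteq> 0" "T \<subseteq> v_closure R S"
    "finite S'" "S' \<subseteq> I" "t \<in> v_closure R S'" by (meson insert_subset t_closureE)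
  then show ?case
    using v_closure_mono[of S "S \<union> S'"] v_closure_mono[of S' "S \<union> S'"]
    by (intro exI[of _ "S \<union> S'"]) auto
qed

lemma t_ideal_t_closure:
  assumes "fractional_ideal R I"
  shows "t_ideal R (t_closure R I)"
proof -
  have I: "submodule R I" "I \<noteq> {0}" using assms by (auto simp: fractional_ideal_def)
  have frac: "fractional_ideal R (t_closure R I)" by (rule fractional_ideal_t_closure) fact
  have "t_closure R (t_closure R I) \<subseteq> t_closure R I"
  proof
    fix x assume "x \<in> t_closure R (t_closure R I)"
    then obtain T where T: "finite T" "T \<subseteq> t_closure R I" "x \<in> v_closure R T" by (meson t_closureE)
    obtain S where S: "finite S" "S \<subseteq> I" "\<exists>s\<in>S. s \<noteq> 0" "T \<subseteq> v_closure R S"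
      using finite_subset_t_closure[OF T(1,2) I(2,1)] by blast
    have "x \<in> v_closure R S" using v_closure_mono[OF S(4)] T by (auto simp: v_closure_idem)
    then show "x \<in> t_closure R I" using S I by (intro t_closureI[of S]) auto
  qed
  with frac subset_t_closure[of "t_closure R I"] show ?thesis
    by (auto simp: t_ideal_def fractional_ideal_def)
qed

lemma t_ideal_scaled:
  assumes "t_ideal R I" "c \<noteq> 0"
  shows "t_ideal R (scaled c I)"
proof -
  have "fractional_ideal R I" "submodule R I" "t_closure R I = I"
    using assms by (auto simp: t_ideal_def fractional_ideal_def)
  with assms show ?thesis by (simp add: t_ideal_def fractional_ideal_scaled t_closure_scaled)
qed

section \<open>Products of ideals and the \<open>t\<close>-class semigroup\<close>

lemma ideal_product_mult: "x \<in> I \<Longrightarrow> y \<in> J \<Longrightarrow> x * y \<in> ideal_product R I J"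
  unfolding ideal_product_def by (intro hull_inc) auto

lemma submodule_ideal_product: "submodule R (ideal_product R I J)"
  unfolding ideal_product_def by (rule submodule_hull)

lemma ideal_product_le:
  "submodule R A \<Longrightarrow> (\<And>x y. x \<in> I \<Longrightarrow> y \<in> J \<Longrightarrow> x * y \<in> A) \<Longrightarrow> ideal_product R I J \<subseteq> A"
  unfolding ideal_product_def by (rule hull_le) auto

lemma fractional_ideal_product:
  assumes "fractional_ideal R I" "fractional_ideal R J"
  shows "fractional_ideal R (ideal_product R I J)"
proof -
  obtain x d where I: "submodule R I" "x \<in> I" "x \<noteq> 0" "d \<in> R" "d \<noteq> 0" "\<forall>y\<in>I. d * y \<in> R"
    using assms(1) by (rule fractional_idealE)
  obtain x' d' where J: "submodule R J" "x' \<in> J" "x' \<noteq> 0" "d' \<in> R" "d' \<noteq> 0" "\<forall>y\<in>J. d' * y \<in> R"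
    using assms(2) by (rule fractional_idealE)
  have "ideal_product R I J \<subseteq> {z. d * d' * z \<in> R}"
  proof (rule ideal_product_le)
    show "submodule R {z. d * d' * z \<in> R}"
      by (auto simp: submodule_def distrib_left mult.left_commute intro: add_in mult_in)
    show "x * y \<in> {z. d * d' * z \<in> R}" if "x \<in> I" "y \<in> J" for x y
      using mult_in[OF bspec[OF I(6) that(1)] bspec[OF J(6) that(2)]] by (simp add: mult_ac)
  qed
  then show ?thesis
    using I J by (intro fractional_idealI[of _ "x * x'" "d * d'"])
      (auto simp: ideal_product_mult mult_in submodule_ideal_product)
qed

lemma ideal_product_scaled:
  assumes "c \<noteq> 0" "d \<noteq> 0"
  shows "ideal_product R (scaled c I) (scaled d J) = scaled (c * d) (ideal_product R I J)"
proof -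
  have "{x * y |x y. x \<in> scaled c I \<and> y \<in> scaled d J} = scaled (c * d) {x * y |x y. x \<in> I \<and> y \<in> J}"
    (is "?A = ?B")
  proof
    show "?A \<subseteq> ?B"
      by (auto simp: scaled_def image_iff) (metis mult.assoc mult.left_commute)
    show "?B \<subseteq> ?A"
    proof
      fix z assume "z \<in> ?B"
      then obtain x y where "x \<in> I" "y \<in> J" "z = (c * x) * (d * y)"
        by (auto simp: scaled_def mult_ac)
      then show "z \<in> ?A" unfolding scaled_def by blast
    qed
  qed
  then show ?thesis using assms by (simp add: ideal_product_def hull_scaled)
qed

lemma t_ideal_v_closure_pair:
  assumes "a \<in> R" "b \<in> R" "a \<noteq> 0"
  shows "t_ideal R (v_closure R {a, b})"
proof -
  have sub: "{a, b} \<subseteq> v_closure R {a, b}" by (rule subset_v_closure)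
  have "1 \<in> colon R {a, b}" using assms by (auto simp: colon_def)
  then have "y \<in> R" if "y \<in> v_closure R {a, b}" for y using that
    by (auto simp: v_closure_def colon_def[of R "colon _ _"])
  then have frac: "fractional_ideal R (v_closure R {a, b})"
    using sub assms by (intro fractional_idealI[of _ a 1] submodule_v_closure) auto
  moreover have "t_closure R (v_closure R {a, b}) \<subseteq> v_closure R {a, b}"
    using t_closure_le_v_closure[of "v_closure R {a, b}"] by (simp add: v_closure_idem)
  ultimately show ?thesis
    using subset_t_closure by (auto simp: t_ideal_def fractional_ideal_def)
qed

text \<open>
  The relation is oriented as \<open>I = c J\<close>; inverting \<open>c\<close> describes the class of \<open>I\<close> by the multiples
  of \<open>I\<close>.
\<close>

lemma t_class_class:
  assumes "t_ideal R I"
  shows "t_class_rel R `` {I} = {scaled c I | c. c \<noteq> 0}"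
proof -
  have "(I, J) \<in> t_class_rel R \<longleftrightarrow> (\<exists>c. c \<noteq> 0 \<and> J = scaled c I)" for J
  proof
    assume "(I, J) \<in> t_class_rel R"
    then obtain c where "c \<noteq> 0" "I = scaled c J" by (auto simp: t_class_rel_def)
    then show "\<exists>c. c \<noteq> 0 \<and> J = scaled c I" by (intro exI[of _ "inverse c"]) auto
  next
    assume "\<exists>c. c \<noteq> 0 \<and> J = scaled c I"
    then obtain c where c: "c \<noteq> 0" "J = scaled c I" by auto
    then have "I = scaled (inverse c) J" "t_ideal R J" using assms by (simp_all add: t_ideal_scaled)
    with c(1) assms show "(I, J) \<in> t_class_rel R"
      by (auto simp: t_class_rel_def intro!: exI[of _ "inverse c"])
  qed
  then show ?thesis by auto
qed

lemma scaled_class: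
  assumes "d \<noteq> 0"
  shows "{scaled c (scaled d I) | c. c \<noteq> 0} = {scaled c I | c. c \<noteq> 0}"
proof (intro equalityI subsetI)
  fix X assume "X \<in> {scaled c (scaled d I) | c. c \<noteq> 0}"
  then obtain c where "c \<noteq> 0" "X = scaled (c * d) I" by auto
  with assms show "X \<in> {scaled c I | c. c \<noteq> 0}" by (intro CollectI exI[of _ "c * d"]) simp
next
  fix X assume "X \<in> {scaled c I | c. c \<noteq> 0}"
  then obtain c where "c \<noteq> 0" "X = scaled c I" by auto
  with assms show "X \<in> {scaled c (scaled d I) | c. c \<noteq> 0}"
    by (intro CollectI exI[of _ "c / d"]) simp
qed

text \<open>
  Scaling \<open>I\<close> by \<open>c\<close> and \<open>J\<close> by \<open>d\<close> scales \<open>(I J)\<^sub>t\<close> by \<open>c d\<close>, so all representatives of a class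
  contribute the same class to its square, namely the one of \<open>(I\<^sup>2)\<^sub>t\<close>.
\<close>

lemma boole_t_regular_iff:
  "boole_t_regular R \<longleftrightarrow>
    (\<forall>I. t_ideal R I \<longrightarrow> (\<exists>c. c \<noteq> 0 \<and> t_closure R (ideal_product R I I) = scaled c I))"
proof -
  let ?sq = "\<lambda>I. t_closure R (ideal_product R I I)"
  let ?cl = "\<lambda>I. {scaled c I | c. c \<noteq> 0}"
  have sq: "t_ideal R (?sq I)" if "t_ideal R I" for I
    using that by (intro t_ideal_t_closure fractional_ideal_product) (auto simp: t_ideal_def)
  have mult: "t_class_mult R (?cl I) (?cl I) = ?cl (?sq I)" if I: "t_ideal R I" for I
  proof -
    have eq: "t_class_rel R `` {t_closure R (ideal_product R (scaled c I) (scaled d I))} = ?cl (?sq I)"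
      if "c \<noteq> 0" "d \<noteq> 0" for c d
    proof -
      have "submodule R (ideal_product R I I)" by (rule submodule_ideal_product)
      then have "t_closure R (ideal_product R (scaled c I) (scaled d I)) = scaled (c * d) (?sq I)"
        using that by (simp add: ideal_product_scaled t_closure_scaled)
      moreover have "?cl (scaled (c * d) (?sq I)) = ?cl (?sq I)"
        using that by (intro scaled_class) simp
      ultimately show ?thesis
        using t_class_class[OF t_ideal_scaled[OF sq[OF I], of "c * d"]] that by simp
    qed
    have "t_class_mult R (?cl I) (?cl I) =
      (\<Union>c\<in>-{0}. \<Union>d\<in>-{0}. t_class_rel R `` {t_closure R (ideal_product R (scaled c I) (scaled d I))})"
      unfolding t_class_mult_def by blast
    also have "\<dots> = (\<Union>c\<in>-{0::'k}. \<Union>d\<in>-{0::'k}. ?cl (?sq I))"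
      by (intro SUP_cong refl eq) auto
    also have "\<dots> = ?cl (?sq I)" using zero_neq_one by blast
    finally show ?thesis .
  qed
  have "boole_t_regular R \<longleftrightarrow> (\<forall>I. t_ideal R I \<longrightarrow> ?cl (?sq I) = ?cl I)"
    by (auto simp: boole_t_regular_def t_class_semigroup_def quotient_def t_class_class mult)
  moreover have "?cl (?sq I) = ?cl I \<longleftrightarrow> (\<exists>c. c \<noteq> 0 \<and> ?sq I = scaled c I)" for I
  proof
    assume "?cl (?sq I) = ?cl I"
    moreover have "scaled 1 (?sq I) \<in> ?cl (?sq I)"
      by (intro CollectI exI[of _ 1]) (simp del: scaled_one)
    ultimately have "?sq I \<in> ?cl I" by (simp only: scaled_one)
    then show "\<exists>c. c \<noteq> 0 \<and> ?sq I = scaled c I" by auto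
  next
    assume "\<exists>c. c \<noteq> 0 \<and> ?sq I = scaled c I"
    then obtain c where c: "c \<noteq> 0" "?sq I = scaled c I" by blast
    show "?cl (?sq I) = ?cl I" unfolding c(2) using c(1) by (rule scaled_class)
  qed
  ultimately show ?thesis by simp
qed

section \<open>Consequences of stability and of Boole regularity\<close>

lemma strongly_t_stable_witness:
  assumes "c \<in> I" "c \<noteq> 0" "\<And>x y. x \<in> I \<Longrightarrow> y \<in> I \<Longrightarrow> x * y / c \<in> I"
  shows "I = scaled c (colon I I)"
proof
  show "I \<subseteq> scaled c (colon I I)" using assms by (auto simp: scaled_iff colon_def)
  show "scaled c (colon I I) \<subseteq> I" using assms(1) by (auto simp: scaled_def colon_def mult.commute)
qed

text \<open>
  If \<open>c\<close> generates \<open>I\<close> over \<open>(I : I)\<close>, then every \<open>x \<in> I\<close> is \<open>c\<close> times a multiplier of \<open>I\<close>,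
  whence \<open>I\<^sup>2 = c I\<close> even before taking closures.
\<close>

lemma strongly_t_stable_imp_boole:
  assumes "strongly_t_stable R"
  shows "boole_t_regular R"
  unfolding boole_t_regular_iff
proof (intro allI impI)
  fix I assume I: "t_ideal R I"
  then obtain c where c: "c \<in> I" "I = scaled c (colon I I)"
    using assms by (auto simp: strongly_t_stable_def)
  have smI: "submodule R I" "I \<noteq> {0}" "t_closure R I = I"
    using I by (auto simp: t_ideal_def fractional_ideal_def)
  have "c \<noteq> 0" using c smI by (auto simp: scaled_def)
  have "ideal_product R I I = scaled c I"
  proof
    show "ideal_product R I I \<subseteq> scaled c I"
    proof (rule ideal_product_le)
      fix x y assume xy: "x \<in> I" "y \<in> I"
      then have "x / c \<in> colon I I" using c(2) \<open>c \<noteq> 0\<close> scaled_iff by blast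
      with xy have "x * y / c \<in> I" by (auto simp: colon_def)
      then show "x * y \<in> scaled c I" using \<open>c \<noteq> 0\<close> by (simp add: scaled_iff)
    qed (simp add: submodule_scaled smI)
    show "scaled c I \<subseteq> ideal_product R I I"
      using c(1) by (auto simp: scaled_def intro: ideal_product_mult)
  qed
  then have "t_closure R (ideal_product R I I) = scaled c I"
    using smI \<open>c \<noteq> 0\<close> by (simp add: t_closure_scaled)
  with \<open>c \<noteq> 0\<close> show "\<exists>c. c \<noteq> 0 \<and> t_closure R (ideal_product R I I) = scaled c I" by blast
qed

text \<open>
  With \<open>P = c (P : P)\<close>, idempotence \<open>P = (P\<^sup>2)\<^sub>t \<subseteq> c P\<close> says that \<open>1 / c\<close> is a multiplier of \<open>P\<close>;
  applied to \<open>c \<in> P\<close> it gives \<open>1 \<in> P\<close>.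
\<close>

lemma strongly_t_stable_imp_discrete:
  assumes "strongly_t_stable R"
  shows "strongly_t_discrete R"
  unfolding strongly_t_discrete_def
proof (intro allI impI psubsetI)
  fix P assume "t_prime R P"
  then have P: "t_ideal R P" "P \<subset> R" by (auto simp: t_prime_def)
  then have smP: "submodule R P" "P \<noteq> {0}" "t_closure R P = P"
    by (auto simp: t_ideal_def fractional_ideal_def)
  have "ideal_product R P P \<subseteq> P"
    using P smP by (intro ideal_product_le) (auto simp: submodule_def)
  then show "t_closure R (ideal_product R P P) \<subseteq> P" using t_closure_mono smP by metis
  obtain c where c: "c \<in> P" "P = scaled c (colon P P)"
    using assms P unfolding strongly_t_stable_def by blast
  have "c \<noteq> 0" using c smP by (auto simp: scaled_def)
  show "t_closure R (ideal_product R P P) \<noteq> P"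
  proof
    assume eq: "t_closure R (ideal_product R P P) = P"
    have "ideal_product R P P \<subseteq> scaled c P"
    proof (rule ideal_product_le)
      fix x y assume xy: "x \<in> P" "y \<in> P"
      then have "x / c \<in> colon P P" using c(2) \<open>c \<noteq> 0\<close> scaled_iff by blast
      with xy have "x * y / c \<in> P" by (auto simp: colon_def)
      then show "x * y \<in> scaled c P" using \<open>c \<noteq> 0\<close> by (simp add: scaled_iff)
    qed (simp add: submodule_scaled smP)
    then have "P \<subseteq> scaled c P"
      using t_closure_mono[of "ideal_product R P P" "scaled c P"] eq smP \<open>c \<noteq> 0\<close>
      by (simp add: t_closure_scaled)
    then have "inverse c \<in> colon P P"
      using \<open>c \<noteq> 0\<close> by (auto simp: colon_def scaled_iff divide_inverse mult.commute dest!: subsetD)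
    then have "1 \<in> P" using c \<open>c \<noteq> 0\<close> by (auto simp: colon_def)
    then have "R \<subseteq> P" using smP(1) submoduleD(3) by fastforce
    with P show False by blast
  qed
qed

text \<open>
  If \<open>{a, b}\<^sub>v = c R\<close>, then \<open>c\<close> divides \<open>a\<close> and \<open>b\<close>; a common divisor \<open>e\<close> has \<open>1 / e\<close> in the inverse
  of \<open>{a, b}\<close>, so \<open>c / e \<in> R\<close>.
\<close>

lemma gcd_domain_if_v_closures_principal:
  assumes "\<And>a b. a \<in> R \<Longrightarrow> b \<in> R \<Longrightarrow> a \<noteq> 0 \<Longrightarrow> \<exists>c. v_closure R {a, b} = scaled c R"
  shows "gcd_domain R"
  unfolding gcd_domain_def
proof (intro ballI impI)
  fix a b assume ab: "a \<in> R" "b \<in> R" "a \<noteq> 0 \<and> b \<noteq> 0"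
  then obtain c where c: "v_closure R {a, b} = scaled c R" using assms by blast
  have "a \<in> scaled c R" "b \<in> scaled c R" using subset_v_closure[of "{a, b}"] c by auto
  then have dv: "c \<unlhd> a" "c \<unlhd> b" by (auto simp: scaled_def divides_in_def)
  have cin: "c \<in> v_closure R {a, b}" using c one_in by (force simp: scaled_def)
  have gr: "e \<unlhd> c" if "e \<unlhd> a" "e \<unlhd> b" for e
  proof -
    have "e \<noteq> 0" using that ab by auto
    then have "inverse e \<in> colon R {a, b}" using that
      by (auto simp: colon_def divides_iff divide_inverse mult.commute)
    then have "c * inverse e \<in> R" using cin by (auto simp: v_closure_def colon_def)
    then show ?thesis using \<open>e \<noteq> 0\<close> by (simp add: divides_iff divide_inverse)
  qed
  show "\<exists>d\<in>R. d \<unlhd> a \<and> d \<unlhd> b \<and> (\<forall>e\<in>R. e \<unlhd> a \<and> e \<unlhd> b \<longrightarrow> e \<unlhd> d)"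
    using dv gr gr[of 1] ab by (intro bexI[of _ c]) auto
qed

lemma colon_v_closure_pair:
  assumes "v_domain R" "a \<in> R" "b \<in> R" "a \<noteq> 0"
  shows "colon (v_closure R {a, b}) (v_closure R {a, b}) = R"
proof -
  have "fg_submodule R (submodule R hull {a, b})"
    unfolding fg_submodule_def by (intro exI[of _ "{a, b}"]) simp
  moreover have "submodule R hull {a, b} \<noteq> {0}" using assms by (intro hull_nonzero) auto
  moreover have "submodule R hull {a, b} \<subseteq> R" using assms by (intro hull_le submodule_R) auto
  ultimately show ?thesis using assms(1) unfolding v_domain_def by (metis v_closure_hull)
qed

lemma strongly_t_stable_imp_gcd_domain:
  assumes "v_domain R" "strongly_t_stable R"
  shows "gcd_domain R"
proof (rule gcd_domain_if_v_closures_principal)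
  fix a b assume ab: "a \<in> R" "b \<in> R" "a \<noteq> 0"
  have "t_ideal R (v_closure R {a, b})" by (rule t_ideal_v_closure_pair) fact+
  then show "\<exists>c. v_closure R {a, b} = scaled c R"
    using assms(2) colon_v_closure_pair[OF assms(1) ab] unfolding strongly_t_stable_def by metis
qed

text \<open>
  Let \<open>J = {a, b}\<^sub>v\<close> and \<open>(J\<^sup>2)\<^sub>t = c J\<close>.  For \<open>x \<in> J\<close> the quotient \<open>x / c\<close> maps \<open>J\<close> into itself, and
  \<open>(J : J) = R\<close>; hence \<open>J \<subseteq> c R\<close>.  For \<open>x \<in> J\<^sup>-\<^sup>1\<close> one has \<open>x J\<^sup>2 \<subseteq> J\<close>, so \<open>x c\<close> also maps \<open>J\<close>
  into itself and lies in \<open>R\<close>; as \<open>J\<close> is divisorial, \<open>c \<in> J\<close>.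
\<close>

lemma boole_t_regular_imp_gcd_domain:
  assumes "v_domain R" "boole_t_regular R"
  shows "gcd_domain R"
proof (rule gcd_domain_if_v_closures_principal)
  fix a b assume ab: "a \<in> R" "b \<in> R" "a \<noteq> 0"
  define J where "J = v_closure R {a, b}"
  have tJ: "t_ideal R J" unfolding J_def by (rule t_ideal_v_closure_pair) fact+
  have cJ: "colon J J = R" using colon_v_closure_pair[OF assms(1) ab] by (simp add: J_def)
  have smJ: "submodule R J" by (simp add: J_def submodule_v_closure)
  obtain c where c: "c \<noteq> 0" "t_closure R (ideal_product R J J) = scaled c J"
    using assms(2) tJ boole_t_regular_iff by blast
  have smJJ: "fractional_ideal R (ideal_product R J J)"
    using tJ by (intro fractional_ideal_product) (auto simp: t_ideal_def)
  have "J \<subseteq> scaled c R"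
  proof
    fix x assume x: "x \<in> J"
    have "x * y / c \<in> J" if "y \<in> J" for y
      using ideal_product_mult[OF x that] subset_t_closure[of "ideal_product R J J"] smJJ c
      by (auto simp: fractional_ideal_def scaled_iff)
    then have "x / c \<in> colon J J" by (simp add: colon_def)
    then show "x \<in> scaled c R" using c cJ by (simp add: scaled_iff)
  qed
  moreover have "c \<in> J"
  proof -
    have "c * x \<in> R" if x: "x \<in> colon R {a, b}" for x
    proof -
      have xJ: "x * y \<in> R" if "y \<in> J" for y
        using that x unfolding J_def v_closure_def by (auto simp: colon_def[of R "colon _ _"] mult.commute)
      have "x * w \<in> J" if "w \<in> ideal_product R J J" for w
      proof -
        have "ideal_product R J J \<subseteq> {w. x * w \<in> J}"
        proof (rule ideal_product_le)
          show "submodule R {w. x * w \<in> J}"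
            using smJ by (auto simp: submodule_def distrib_left mult.left_commute)
          show "y * z \<in> {w. x * w \<in> J}" if "y \<in> J" "z \<in> J" for y z
            using submoduleD(3)[OF smJ xJ[OF that(1)] that(2)] by (simp add: mult.assoc)
        qed
        with that show ?thesis by auto
      qed
      then have sub: "scaled x (ideal_product R J J) \<subseteq> J" by (auto simp: scaled_def)
      have "c * x * y \<in> J" if y: "y \<in> J" for y
      proof (cases "x = 0")
        case False
        have "c * y \<in> t_closure R (ideal_product R J J)" using y c by (auto simp: scaled_def)
        then have "x * (c * y) \<in> t_closure R (scaled x (ideal_product R J J))"
          using False smJJ by (subst t_closure_scaled) (auto simp: fractional_ideal_def scaled_def)
        then have "x * (c * y) \<in> t_closure R J" using t_closure_mono[OF sub] by blast
        then show ?thesis using tJ by (simp add: t_ideal_def mult_ac)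
      qed (use submoduleD(1)[OF smJ] in auto)
      then show ?thesis using cJ by (auto simp: colon_def)
    qed
    then show ?thesis by (auto simp: J_def v_closure_def colon_def[of R "colon _ _"])
  qed
  ultimately have "J = scaled c R" using smJ by (auto simp: scaled_def submodule_def mult.commute)
  then show "\<exists>c. v_closure R {a, b} = scaled c R" unfolding J_def by blast
qed

section \<open>Greatest common divisors in the quotient field\<close>

text \<open>
  The defining equivalence, with \<open>e\<close> ranging over the whole field, covers zero and non-integral
  elements uniformly and is visibly invariant under scaling.  Coprimality is expressed as
  \<open>is_gcd 1 a b\<close>, which also forces \<open>a\<close> and \<open>b\<close> to lie in \<open>R\<close>.
\<close>

definition is_gcd :: "'k \<Rightarrow> 'k \<Rightarrow> 'k \<Rightarrow> bool" where
  "is_gcd d a b \<longleftrightarrow> (\<forall>e. e \<unlhd> a \<and> e \<unlhd> b \<longleftrightarrow> e \<unlhd> d)"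

lemma is_gcdD:
  assumes "is_gcd d a b"
  shows "d \<unlhd> a" "d \<unlhd> b" "e \<unlhd> a \<Longrightarrow> e \<unlhd> b \<Longrightarrow> e \<unlhd> d"
proof -
  have *: "e \<unlhd> a \<and> e \<unlhd> b \<longleftrightarrow> e \<unlhd> d" for e using assms unfolding is_gcd_def by blast
  show "d \<unlhd> a" "d \<unlhd> b" "e \<unlhd> a \<Longrightarrow> e \<unlhd> b \<Longrightarrow> e \<unlhd> d" using *[of d] *[of e] by simp_all
qed

lemma is_gcdI:
  assumes "d \<unlhd> a" "d \<unlhd> b" "\<And>e. e \<unlhd> a \<Longrightarrow> e \<unlhd> b \<Longrightarrow> e \<unlhd> d"
  shows "is_gcd d a b"
  using assms divides_trans unfolding is_gcd_def by blast

lemma is_gcd_commute: "is_gcd d a b \<longleftrightarrow> is_gcd d b a"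
  unfolding is_gcd_def by (simp add: conj_commute)

lemma is_gcd_in_R: "is_gcd d a b \<Longrightarrow> a \<in> R \<Longrightarrow> b \<in> R \<Longrightarrow> d \<in> R"
  using is_gcdD(3)[of d a b 1] by simp

lemma is_gcd_scale:
  assumes "is_gcd d a b"
  shows "is_gcd (c * d) (c * a) (c * b)"
proof (cases "c = 0")
  case False
  then have "e \<unlhd> c * x \<longleftrightarrow> e / c \<unlhd> x" for e x
    using divides_mult_cancel[of c "e / c" x] by simp
  then show ?thesis using assms by (simp add: is_gcd_def)
qed (simp add: is_gcd_def)

lemma is_gcd_zero: "is_gcd d 0 0 \<Longrightarrow> d = 0"
  using is_gcdD(3)[of d 0 0 0] by simp

lemma coprime_in_R: "is_gcd 1 a b \<Longrightarrow> a \<in> R" "is_gcd 1 a b \<Longrightarrow> b \<in> R"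
  using is_gcdD[of 1 a b] by simp_all

lemma coprime_cancel: "is_gcd 1 a b \<Longrightarrow> e \<unlhd> c * a \<Longrightarrow> e \<unlhd> c * b \<Longrightarrow> e \<unlhd> c"
  using is_gcd_scale[of 1 a b c] is_gcdD(3) by force

text \<open>
  Euclid's lemma.  Integrality of \<open>c\<close> is essential: over the quotient field \<open>a\<close> divides \<open>a * c\<close> only
  if \<open>c \<in> R\<close> (for nonzero \<open>a\<close>).
\<close>

lemma coprime_divides:
  assumes "is_gcd 1 a b" "a \<unlhd> b * c" "c \<in> R"
  shows "a \<unlhd> c"
  using coprime_cancel[OF assms(1), of a c] divides_mult_right[of a a c] assms(2,3)
  by (simp add: mult.commute)

lemma coprime_mult:
  assumes "is_gcd 1 a b" "is_gcd 1 a c"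
  shows "is_gcd 1 a (b * c)"
proof (rule is_gcdI)
  have R: "a \<in> R" "b \<in> R" "c \<in> R" using assms coprime_in_R by blast+
  then show "1 \<unlhd> a" "1 \<unlhd> b * c" by (auto intro: mult_in)
  fix e assume e: "e \<unlhd> a" "e \<unlhd> b * c"
  then have "e \<unlhd> c * a" "e \<unlhd> c * b" using R divides_mult_right[of e a c] by (simp_all add: mult.commute)
  then have "e \<unlhd> c" using assms coprime_cancel by blast
  then show "e \<unlhd> 1" using e assms is_gcdD(3) by blast
qed

lemma coprime_power_right: "is_gcd 1 a b \<Longrightarrow> is_gcd 1 a (b ^ n)"
proof (induction n)
  case 0
  then show ?case by (intro is_gcdI) (auto dest: coprime_in_R)
qed (auto intro: coprime_mult)

lemma coprime_power: "is_gcd 1 a b \<Longrightarrow> is_gcd 1 (a ^ m) (b ^ n)"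
  using coprime_power_right is_gcd_commute by metis

lemma coprime_divisor:
  assumes "is_gcd 1 a b" "c \<unlhd> b" "c \<in> R"
  shows "is_gcd 1 a c"
  using assms by (intro is_gcdI) (auto intro: divides_trans dest: coprime_in_R is_gcdD(3))

lemma is_gcd_power:
  assumes "is_gcd d a b"
  shows "is_gcd (d ^ n) (a ^ n) (b ^ n)"
proof (cases "d = 0")
  case True
  then have "a = 0" "b = 0" using is_gcdD(1,2)[OF assms] by auto
  with True show ?thesis by (intro is_gcdI) auto
next
  case False
  obtain a' b' where ab: "a = d * a'" "b = d * b'"
    using is_gcdD(1,2)[OF assms] unfolding divides_in_def by blast
  then have "is_gcd 1 a' b'" using is_gcd_scale[OF assms, of "inverse d"] False by (simp flip: mult.assoc)
  then show ?thesis
    using is_gcd_scale[OF coprime_power, of a' b' "d ^ n" n n] ab by (simp add: power_mult_distrib)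
qed

lemma power_divides_power: "a \<in> R \<Longrightarrow> m \<le> n \<Longrightarrow> a ^ m \<unlhd> a ^ n"
  using divides_mult_right[of "a ^ m" "a ^ m" "a ^ (n - m)"] power_in[of a]
  by (simp flip: power_add)

section \<open>Ideals closed under gcds\<close>

definition gcd_ideal :: "'k set \<Rightarrow> bool" where
  "gcd_ideal I \<longleftrightarrow> 0 \<in> I \<and> (\<forall>x\<in>I. \<forall>y. x \<unlhd> y \<longrightarrow> y \<in> I) \<and>
     (\<forall>x\<in>I. \<forall>y\<in>I. \<forall>d. is_gcd d x y \<longrightarrow> d \<in> I)"

lemma gcd_idealD:
  assumes "gcd_ideal I"
  shows "0 \<in> I" "x \<in> I \<Longrightarrow> x \<unlhd> y \<Longrightarrow> y \<in> I" "x \<in> I \<Longrightarrow> y \<in> I \<Longrightarrow> is_gcd d x y \<Longrightarrow> d \<in> I"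
  using assms unfolding gcd_ideal_def by blast+

lemma gcd_ideal_mult: "gcd_ideal I \<Longrightarrow> x \<in> I \<Longrightarrow> r \<in> R \<Longrightarrow> x * r \<in> I"
  by (rule gcd_idealD(2)[of I x]) (auto simp: divides_in_def)

lemma gcd_ideal_R: "gcd_ideal R"
  using divides_in_R is_gcd_in_R by (auto simp: gcd_ideal_def)

lemma gcd_ideal_Int: "gcd_ideal I \<Longrightarrow> gcd_ideal J \<Longrightarrow> gcd_ideal (I \<inter> J)"
  unfolding gcd_ideal_def by blast

lemma gcd_ideal_Union_chain:
  assumes "C \<noteq> {}" "\<And>I. I \<in> C \<Longrightarrow> gcd_ideal I" "\<And>I J. I \<in> C \<Longrightarrow> J \<in> C \<Longrightarrow> I \<subseteq> J \<or> J \<subseteq> I"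
  shows "gcd_ideal (\<Union>C)"
  unfolding gcd_ideal_def
proof (intro conjI ballI allI impI)
  show "0 \<in> \<Union>C" using assms gcd_idealD(1) by blast
next
  fix x y assume "x \<in> \<Union>C" "x \<unlhd> y"
  then show "y \<in> \<Union>C" using assms(2) gcd_idealD(2) by blast
next
  fix x y d assume "x \<in> \<Union>C" "y \<in> \<Union>C" and d: "is_gcd d x y"
  then obtain I J where "I \<in> C" "J \<in> C" "x \<in> I" "y \<in> J" by blast
  with assms(3) obtain I where "I \<in> C" "x \<in> I" "y \<in> I" by blast
  then show "d \<in> \<Union>C" using assms(2) gcd_idealD(3) d by blast
qed

lemma gcd_ideal_principal: "gcd_ideal {x. a \<unlhd> x}"
  unfolding gcd_ideal_def using divides_trans is_gcdD(3) divides_zero by blast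

lemma gcd_ideal_quotient:
  assumes "gcd_ideal I"
  shows "gcd_ideal {r. r * u \<in> I}"
  unfolding gcd_ideal_def
proof (intro conjI ballI allI impI)
  show "0 \<in> {r. r * u \<in> I}" using gcd_idealD(1)[OF assms] by simp
next
  fix x y assume x: "x \<in> {r. r * u \<in> I}" "x \<unlhd> y"
  have "x * u \<unlhd> y * u" using x(2) by (intro divides_mult) auto
  then show "y \<in> {r. r * u \<in> I}" using x(1) gcd_idealD(2)[OF assms, of "x * u"] by simp
next
  fix x y d assume x: "x \<in> {r. r * u \<in> I}" "y \<in> {r. r * u \<in> I}" "is_gcd d x y"
  show "d \<in> {r. r * u \<in> I}"
    using is_gcd_scale[OF x(3), of u] x(1,2) gcd_idealD(3)[OF assms, of "u * x" "u * y"]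
    by (simp add: mult.commute)
qed

end

section \<open>The \<open>t\<close>-ideals of a GCD domain\<close>

locale gcd_quotient_field_domain = quotient_field_domain +
  assumes gcd: "gcd_domain R"
begin

text \<open>
  Common denominators reduce this to \<open>a\<close> and \<open>b\<close> in \<open>R\<close>, where the gcd within \<open>R\<close> is known to be
  greatest only among the common divisors in \<open>R\<close>.  A fractional common divisor \<open>p / q\<close> becomes the
  integral common divisor \<open>p\<close> of \<open>q a\<close> and \<open>q b\<close>, and gcds commute with multiplication by \<open>q\<close>.
\<close>

lemma gcd_exists: "\<exists>d. is_gcd d a b"
proof -
  have in_R: "\<exists>d. is_gcd d a b" if ab: "a \<in> R" "b \<in> R" "a \<noteq> 0" "b \<noteq> 0" for a b
  proof -
    have *: "\<exists>d\<in>R. d \<unlhd> a \<and> d \<unlhd> b \<and> (\<forall>e\<in>R. e \<unlhd> a \<and> e \<unlhd> b \<longrightarrow> e \<unlhd> d)"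
      if "a \<in> R" "b \<in> R" "a \<noteq> 0" "b \<noteq> 0" for a b
      using gcd that by (simp add: gcd_domain_def)
    obtain d where d: "d \<in> R" "d \<unlhd> a" "d \<unlhd> b" "\<forall>e\<in>R. e \<unlhd> a \<and> e \<unlhd> b \<longrightarrow> e \<unlhd> d"
      using *[OF ab] by blast
    have "e \<unlhd> d" if e: "e \<unlhd> a" "e \<unlhd> b" for e
    proof -
      obtain p q where pq: "p \<in> R" "q \<in> R" "q \<noteq> 0" "e = p / q" by (rule fraction_cases)
      have p: "p = q * e" using pq by simp
      obtain g where g: "g \<unlhd> q * a" "g \<unlhd> q * b" "\<forall>e\<in>R. e \<unlhd> q * a \<and> e \<unlhd> q * b \<longrightarrow> e \<unlhd> g"
        using *[of "q * a" "q * b"] pq ab mult_in by auto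
      have "q \<unlhd> q * a" "q \<unlhd> q * b" using ab divides_mult_right[of q q] by simp_all
      then obtain h where h: "h \<in> R" "g = q * h"
        using g(3) pq(2) unfolding divides_in_def by blast
      have "h \<unlhd> d" using g(1,2) h pq(3) d(4) by (simp add: divides_mult_cancel)
      then have "g \<unlhd> q * d" using h pq(3) by (simp add: divides_mult_cancel)
      moreover have "p \<unlhd> g" using g(3) pq(1,3) p e by (simp add: divides_mult_cancel)
      ultimately have "q * e \<unlhd> q * d" using p divides_trans by metis
      then show ?thesis using pq(3) by (simp add: divides_mult_cancel)
    qed
    with d show ?thesis by (intro exI[of _ d] is_gcdI)
  qed
  show ?thesis
  proof (cases "a = 0 \<or> b = 0")
    case True
    moreover have "is_gcd b 0 b" "is_gcd a a 0" by (simp_all add: is_gcd_def)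
    ultimately show ?thesis by blast
  next
    case False
    obtain p q where pq: "p \<in> R" "q \<in> R" "q \<noteq> 0" "a = p / q" by (rule fraction_cases)
    obtain p' q' where pq': "p' \<in> R" "q' \<in> R" "q' \<noteq> 0" "b = p' / q'" by (rule fraction_cases)
    obtain d where "is_gcd d (p * q') (p' * q)"
      using in_R[of "p * q'" "p' * q"] pq pq' False mult_in by auto
    then have "is_gcd (inverse (q * q') * d) a b"
      using is_gcd_scale[of d "p * q'" "p' * q" "inverse (q * q')"] pq(3) pq'(3)
      unfolding pq(4) pq'(4) by (simp add: field_simps)
    then show ?thesis by blast
  qed
qed

lemma gcd_split:
  assumes "a \<noteq> 0 \<or> b \<noteq> 0"
  obtains d a' b' where "d \<noteq> 0" "is_gcd d a b" "a = d * a'" "b = d * b'" "is_gcd 1 a' b'"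
proof -
  obtain d where d: "is_gcd d a b" using gcd_exists by blast
  obtain a' b' where ab: "a = d * a'" "b = d * b'"
    using is_gcdD(1,2)[OF d] unfolding divides_in_def by blast
  have "d \<noteq> 0" using assms ab by auto
  then have "is_gcd 1 a' b'"
    using ab is_gcd_scale[OF d, of "inverse d"] by (simp flip: mult.assoc)
  then show thesis using that d ab \<open>d \<noteq> 0\<close> by blast
qed

text \<open>
  Closure under sums is automatic: \<open>x + y\<close> is a multiple of the gcd of \<open>x\<close> and \<open>y\<close>.
\<close>

lemma gcd_ideal_submodule:
  assumes "gcd_ideal I"
  shows "submodule R I"
  unfolding submodule_def
proof (intro conjI ballI)
  fix x y assume xy: "x \<in> I" "y \<in> I"
  obtain d where d: "is_gcd d x y" using gcd_exists by blast
  then have "d \<in> I" using xy assms gcd_idealD(3) by blast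
  moreover have "d \<unlhd> x + y" using is_gcdD(1,2)[OF d] by (simp add: divides_add)
  ultimately show "x + y \<in> I" using assms gcd_idealD(2) by blast
next
  fix r x assume "r \<in> R" "x \<in> I"
  then show "r * x \<in> I" using gcd_ideal_mult[OF assms, of x r] by (simp add: mult.commute)
qed (rule gcd_idealD(1)[OF assms])

text \<open>
  The gcd is built from its arguments by binary gcds, starting from \<open>0\<close>; this is why it stays in every
  gcd-closed ideal that contains them.
\<close>

lemma finite_gcd_exists:
  assumes "finite S"
  shows "\<exists>g. (\<forall>e. (\<forall>s\<in>S. e \<unlhd> s) \<longleftrightarrow> e \<unlhd> g) \<and> (\<forall>I. gcd_ideal I \<longrightarrow> S \<subseteq> I \<longrightarrow> g \<in> I)"
  using assms
proof (induction S)
  case empty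
  show ?case using gcd_idealD(1) by (intro exI[of _ 0]) simp
next
  case (insert s S)
  then obtain g where g: "\<forall>e. (\<forall>s\<in>S. e \<unlhd> s) \<longleftrightarrow> e \<unlhd> g" "\<forall>I. gcd_ideal I \<longrightarrow> S \<subseteq> I \<longrightarrow> g \<in> I"
    by blast
  obtain d where d: "is_gcd d s g" using gcd_exists by blast
  then have "\<forall>I. gcd_ideal I \<longrightarrow> insert s S \<subseteq> I \<longrightarrow> d \<in> I"
    using g(2) gcd_idealD(3) by (metis insert_subset)
  moreover have "\<forall>e. (\<forall>s\<in>insert s S. e \<unlhd> s) \<longleftrightarrow> e \<unlhd> d"
    using g(1) d by (simp add: is_gcd_def)
  ultimately show ?case by blast
qed

lemma v_closure_eq_multiples:
  assumes g: "\<And>e. (\<forall>s\<in>S. e \<unlhd> s) \<longleftrightarrow> e \<unlhd> g" and S: "\<exists>s\<in>S. s \<noteq> 0"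
  shows "v_closure R S = {x. g \<unlhd> x}"
proof -
  have "g \<noteq> 0" using g[of g] S by auto
  have colon: "colon R S = {y. y * g \<in> R}"
  proof -
    have "y \<in> colon R S \<longleftrightarrow> y * g \<in> R" for y
    proof (cases "y = 0")
      case False
      then have "y * s \<in> R \<longleftrightarrow> inverse y \<unlhd> s" for s
        by (simp add: divides_iff divide_inverse mult.commute)
      then show ?thesis using g[of "inverse y"] by (simp add: colon_def)
    qed (simp add: colon_def)
    then show ?thesis by blast
  qed
  show ?thesis
  proof (intro equalityI subsetI CollectI)
    fix x assume "x \<in> v_closure R S"
    then have "x * inverse g \<in> R"
      using \<open>g \<noteq> 0\<close> unfolding v_closure_def colon by (simp add: colon_def)
    then show "g \<unlhd> x" using \<open>g \<noteq> 0\<close> by (simp add: divides_iff divide_inverse)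
  next
    fix x assume "x \<in> {x. g \<unlhd> x}"
    then obtain c where c: "c \<in> R" "x = g * c" by (auto simp: divides_in_def)
    have "x * y \<in> R" if "y * g \<in> R" for y
      using mult_in[OF that c(1)] c(2) by (simp add: mult_ac)
    then show "x \<in> v_closure R S" unfolding v_closure_def colon by (simp add: colon_def)
  qed
qed

lemma t_closure_gcd_ideal:
  assumes "gcd_ideal I"
  shows "t_closure R I \<subseteq> I"
proof
  fix x assume "x \<in> t_closure R I"
  then obtain S where S: "finite S" "S \<subseteq> I" "x \<in> v_closure R S" "\<exists>s\<in>S. s \<noteq> 0"
    by (rule t_closureE)
  then obtain g where g: "\<And>e. (\<forall>s\<in>S. e \<unlhd> s) \<longleftrightarrow> e \<unlhd> g" "g \<in> I"
    using finite_gcd_exists assms by metis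
  then have "g \<unlhd> x" using v_closure_eq_multiples[OF g(1) S(4)] S(3) by simp
  then show "x \<in> I" using g(2) assms gcd_idealD(2) by blast
qed

text \<open>
  The \<open>v\<close>-closure of a finite set is generated by its gcd, so being \<open>t\<close>-closed amounts to containing the
  gcds of finitely many, equivalently of two, elements.
\<close>

lemma t_ideal_iff:
  "t_ideal R I \<longleftrightarrow> gcd_ideal I \<and> (\<exists>x\<in>I. x \<noteq> 0) \<and> (\<exists>d\<in>R. d \<noteq> 0 \<and> (\<forall>y\<in>I. d * y \<in> R))"
proof
  assume I: "t_ideal R I"
  obtain x d where xd: "submodule R I" "x \<in> I" "x \<noteq> 0" "d \<in> R" "d \<noteq> 0" "\<forall>y\<in>I. d * y \<in> R"
    using I fractional_idealE unfolding t_ideal_def by blast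
  have "gcd_ideal I"
    unfolding gcd_ideal_def
  proof (intro conjI ballI allI impI)
    fix x y d assume xy: "x \<in> I" "y \<in> I" and d: "is_gcd d x y"
    show "d \<in> I"
    proof (cases "x = 0 \<and> y = 0")
      case True
      with d is_gcd_zero xy show ?thesis by blast
    next
      case False
      have "v_closure R {x, y} = {z. d \<unlhd> z}"
        using False d by (intro v_closure_eq_multiples) (auto simp: is_gcd_def)
      then have "d \<in> v_closure R {x, y}" by simp
      then have "d \<in> t_closure R I"
        using False xy xd by (intro t_closureI[of "{x, y}"]) auto
      then show ?thesis using I by (simp add: t_ideal_def)
    qed
  qed (use submoduleD(1)[OF xd(1)] submodule_divides[OF xd(1)] in blast)+
  with xd show "gcd_ideal I \<and> (\<exists>x\<in>I. x \<noteq> 0) \<and> (\<exists>d\<in>R. d \<noteq> 0 \<and> (\<forall>y\<in>I. d * y \<in> R))" by blast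
next
  assume R: "gcd_ideal I \<and> (\<exists>x\<in>I. x \<noteq> 0) \<and> (\<exists>d\<in>R. d \<noteq> 0 \<and> (\<forall>y\<in>I. d * y \<in> R))"
  then have "fractional_ideal R I"
    using gcd_ideal_submodule fractional_idealI by blast
  with R subset_t_closure[of I] t_closure_gcd_ideal[of I] show "t_ideal R I"
    by (auto simp: t_ideal_def fractional_ideal_def)
qed

lemma t_ideal_gcd_ideal: "t_ideal R I \<Longrightarrow> gcd_ideal I"
  by (simp add: t_ideal_iff)

lemma integral_t_ideal_iff:
  "t_ideal R I \<and> I \<subseteq> R \<longleftrightarrow> gcd_ideal I \<and> (\<exists>x\<in>I. x \<noteq> 0) \<and> I \<subseteq> R"
proof -
  have "\<exists>d\<in>R. d \<noteq> 0 \<and> (\<forall>y\<in>I. d * y \<in> R)" if "I \<subseteq> R"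
    using that by (intro bexI[of _ 1]) auto
  then show ?thesis unfolding t_ideal_iff by blast
qed

lemma gcd_ideal_proper_iff:
  assumes "gcd_ideal I" "I \<subseteq> R"
  shows "I \<subset> R \<longleftrightarrow> 1 \<notin> I"
  using assms gcd_ideal_mult[OF assms(1), of 1] by auto

text \<open>
  The multiples of squares of elements of \<open>J\<close> form a gcd-closed ideal: multiples of \<open>a\<^sup>2\<close> and \<open>b\<^sup>2\<close> are
  both multiples of \<open>g\<^sup>2\<close> for \<open>g\<close> the gcd of \<open>a\<close> and \<open>b\<close>, and so is \<open>a b\<close>.
\<close>

lemma t_closure_square:
  assumes J: "gcd_ideal J" and x: "x \<in> t_closure R (ideal_product R J J)"
  shows "\<exists>a\<in>J. a\<^sup>2 \<unlhd> x"
proof -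
  define U where "U = {x. \<exists>a\<in>J. a\<^sup>2 \<unlhd> x}"
  have common: "\<exists>a\<in>J. a\<^sup>2 \<unlhd> x \<and> a\<^sup>2 \<unlhd> y \<and> a \<unlhd> a1 \<and> a \<unlhd> a2"
    if "a1 \<in> J" "a2 \<in> J" "a1\<^sup>2 \<unlhd> x" "a2\<^sup>2 \<unlhd> y" for x y a1 a2
  proof -
    obtain a where a: "is_gcd a a1 a2" using gcd_exists by blast
    then have "a \<in> J" using that J gcd_idealD(3) by blast
    with is_gcdD(1,2)[OF a] that show ?thesis
      by (intro bexI[of _ a]) (auto intro: divides_trans divides_power)
  qed
  have U: "gcd_ideal U"
    unfolding gcd_ideal_def
  proof (intro conjI ballI allI impI)
    show "0 \<in> U" using gcd_idealD(1)[OF J] unfolding U_def by simp blast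
  next
    fix x y assume "x \<in> U" "x \<unlhd> y"
    then show "y \<in> U" unfolding U_def using divides_trans by blast
  next
    fix x y d assume "x \<in> U" "y \<in> U" and d: "is_gcd d x y"
    then obtain a where "a \<in> J" "a\<^sup>2 \<unlhd> x" "a\<^sup>2 \<unlhd> y" using common unfolding U_def by blast
    then show "d \<in> U" using is_gcdD(3)[OF d] by (auto simp: U_def)
  qed
  have "ideal_product R J J \<subseteq> U"
  proof (rule ideal_product_le)
    show "submodule R U" using U by (rule gcd_ideal_submodule)
    fix x y assume xy: "x \<in> J" "y \<in> J"
    then obtain a where "a \<in> J" "a \<unlhd> x" "a \<unlhd> y" using common[of x y "x\<^sup>2" "y\<^sup>2"] by auto
    then show "x * y \<in> U" unfolding U_def power2_eq_square using divides_mult by blast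
  qed
  then have "x \<in> U" using x t_closure_mono t_closure_gcd_ideal[OF U] by blast
  then show ?thesis by (simp add: U_def)
qed

text \<open>
  If every element of \<open>P\<close> were a multiple of the square of an element of \<open>P\<close>, then \<open>P\<close> would lie in
  \<open>P\<^sup>2\<close>.
\<close>

lemma strongly_t_discreteD:
  assumes "strongly_t_discrete R" "t_prime R P"
  shows "\<exists>z\<in>P. \<forall>b\<in>P. \<not> b\<^sup>2 \<unlhd> z"
proof (rule ccontr)
  assume sq: "\<not> ?thesis"
  have "t_ideal R P" using assms by (simp add: t_prime_def)
  then obtain p where p: "p \<in> P" "p \<noteq> 0" unfolding t_ideal_iff by blast
  have "P \<subseteq> ideal_product R P P"
  proof
    fix z assume "z \<in> P"
    then obtain b where "b \<in> P" "b\<^sup>2 \<unlhd> z" using sq by blast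
    then show "z \<in> ideal_product R P P"
      using ideal_product_mult submodule_divides[OF submodule_ideal_product]
      unfolding power2_eq_square by blast
  qed
  moreover have "ideal_product R P P \<subseteq> t_closure R (ideal_product R P P)"
    using p calculation by (intro subset_t_closure submodule_ideal_product) auto
  ultimately show False using assms unfolding strongly_t_discrete_def by blast
qed

section \<open>Idempotent \<open>t\<close>-ideals and idempotent \<open>t\<close>-primes\<close>

lemma t_primeI:
  assumes "gcd_ideal P" "P \<subseteq> R" "1 \<notin> P" "x \<in> P" "x \<noteq> 0"
    and "\<And>a b. a \<in> R \<Longrightarrow> b \<in> R \<Longrightarrow> a * b \<in> P \<Longrightarrow> a \<in> P \<or> b \<in> P"
  shows "t_prime R P"
  using assms gcd_ideal_proper_iff integral_t_ideal_iff[of P] unfolding t_prime_def by blast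

text \<open>
  Each passage to a square divisor doubles the exponent; smaller exponents follow since \<open>Q \<subseteq> R\<close>.
\<close>

lemma power_divisor_exists:
  assumes sq: "\<forall>x\<in>Q. \<exists>a\<in>Q. a\<^sup>2 \<unlhd> x" and Q: "Q \<subseteq> R" and x: "x \<in> Q"
  shows "\<exists>a\<in>Q. a ^ n \<unlhd> x"
proof -
  have "\<exists>a\<in>Q. a ^ Suc n \<unlhd> x"
    using x
  proof (induction n arbitrary: x)
    case 0
    then show ?case by (intro bexI[of _ x]) auto
  next
    case (Suc n)
    obtain b where b: "b \<in> Q" "b\<^sup>2 \<unlhd> x" using sq Suc.prems by blast
    then obtain a where a: "a \<in> Q" "a ^ Suc n \<unlhd> b" using Suc.IH by blast
    have "a ^ Suc (Suc n) \<unlhd> a ^ (Suc n * 2)" using a Q by (intro power_divides_power) auto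
    also have "a ^ (Suc n * 2) = (a ^ Suc n)\<^sup>2" by (rule power_mult)
    finally have "a ^ Suc (Suc n) \<unlhd> b\<^sup>2" using divides_power[OF a(2), of 2] divides_trans by blast
    then show ?case using a b divides_trans by blast
  qed
  then obtain a where a: "a \<in> Q" "a ^ Suc n \<unlhd> x" by blast
  have "a ^ n \<unlhd> a ^ Suc n" using a Q by (intro power_divides_power) auto
  then show ?thesis using a divides_trans by blast
qed

text \<open>
  The hypothesis on squares expresses that \<open>Q\<close> is \<open>t\<close>-idempotent.  The prime \<open>P\<close> is a minimal prime over \<open>Q\<close>,
  obtained as the complement of a maximal multiplicative set \<open>S\<close> disjoint from \<open>Q\<close>; maximality means
  that each \<open>x \<in> P\<close> satisfies \<open>s x\<^sup>n \<in> Q\<close> for some \<open>s \<in> S\<close>.  Gcds commute with powers, which makes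
  \<open>P\<close> closed under gcds.  To find the square divisor of \<open>x \<in> P\<close>, choose \<open>a \<in> Q\<close> such that \<open>a ^ (2 * n)\<close>
  divides \<open>s x\<^sup>n\<close>.  Cancelling the gcd \<open>d\<close> of \<open>a\<^sup>2\<close> and \<open>x\<close> leaves a factor \<open>u = a\<^sup>2 / d\<close> whose power
  divides \<open>s\<close>, so \<open>u \<notin> P\<close>; up to this factor, \<open>x\<close> is divisible by \<open>a\<^sup>2\<close>, and removing from \<open>a\<close> its
  gcd with \<open>u\<close> gives an honest square divisor.
\<close>

lemma square_divisible_t_prime_exists:
  assumes Q: "gcd_ideal Q" "Q \<subseteq> R" "1 \<notin> Q" "q \<in> Q" "q \<noteq> 0"
    and sq: "\<forall>x\<in>Q. \<exists>a\<in>Q. a\<^sup>2 \<unlhd> x"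
  shows "\<exists>P. t_prime R P \<and> (\<forall>x\<in>P. \<exists>a\<in>P. a\<^sup>2 \<unlhd> x)"
proof -
  define \<A> where "\<A> = {S. S \<subseteq> R \<and> 1 \<in> S \<and> (\<forall>x\<in>S. \<forall>y\<in>S. x * y \<in> S) \<and> S \<inter> Q = {}}"
  have "\<exists>S\<in>\<A>. \<forall>X\<in>\<A>. S \<subseteq> X \<longrightarrow> X = S"
  proof (rule subset_Zorn_nonempty)
    show "\<A> \<noteq> {}" using Q by (auto simp: \<A>_def intro!: exI[of _ "{1}"])
    fix C assume C: "C \<noteq> {}" "subset.chain \<A> C"
    have ch: "X \<subseteq> Y \<or> Y \<subseteq> X" if "X \<in> C" "Y \<in> C" for X Y
      using C(2) that unfolding subset.chain_def by blast
    have sub: "X \<in> \<A>" if "X \<in> C" for X using C(2) that unfolding subset.chain_def by blast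
    have "x * y \<in> \<Union>C" if xy: "x \<in> \<Union>C" "y \<in> \<Union>C" for x y
    proof -
      obtain X Y where "X \<in> C" "Y \<in> C" "x \<in> X" "y \<in> Y" using xy by blast
      with ch obtain X where "X \<in> C" "x \<in> X" "y \<in> X" by blast
      then show ?thesis using sub unfolding \<A>_def by blast
    qed
    then show "\<Union>C \<in> \<A>" using C(1) sub unfolding \<A>_def by blast
  qed
  then obtain S where "S \<in> \<A>" and max: "\<And>X. X \<in> \<A> \<Longrightarrow> S \<subseteq> X \<Longrightarrow> X = S" by blast
  then have S: "S \<subseteq> R" "1 \<in> S" "\<And>x y. x \<in> S \<Longrightarrow> y \<in> S \<Longrightarrow> x * y \<in> S" "\<And>x. x \<in> S \<Longrightarrow> x \<notin> Q"
    unfolding \<A>_def by blast+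
  have S_power: "x ^ n \<in> S" if "x \<in> S" for x n using that S by (induction n) auto
  define P where "P = R - S"
  have meets: "\<exists>s\<in>S. \<exists>n. s * x ^ n \<in> Q" if x: "x \<in> P" for x
  proof (rule ccontr)
    assume no: "\<not> ?thesis"
    \<comment> \<open>The multiplicative set generated by \<open>S\<close> and \<open>x\<close> would be larger than \<open>S\<close>.\<close>
    define X where "X = {s * x ^ n | s n. s \<in> S}"
    have "X \<subseteq> R" using x S(1) by (auto simp: X_def P_def intro!: mult_in power_in)
    moreover have "S \<subseteq> X" unfolding X_def using power_0 mult_1_right by (smt (verit) CollectI subsetI)
    moreover have "a * b \<in> X" if ab: "a \<in> X" "b \<in> X" for a b
    proof -
      obtain s m t n where st: "a = s * x ^ m" "b = t * x ^ n" "s \<in> S" "t \<in> S"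
        using ab unfolding X_def by blast
      then have "a * b = (s * t) * x ^ (m + n)" by (simp add: power_add mult_ac)
      then show ?thesis using st S(3) unfolding X_def by blast
    qed
    moreover have "X \<inter> Q = {}" using no by (auto simp: X_def)
    ultimately have "X = S" using S(2) by (intro max) (auto simp: \<A>_def)
    moreover have "1 * x ^ 1 \<in> X" unfolding X_def using S(2) by blast
    ultimately show False using x by (simp add: P_def)
  qed
  have P: "gcd_ideal P"
    unfolding gcd_ideal_def
  proof (intro conjI ballI allI impI)
    show "0 \<in> P" using S(4) gcd_idealD(1)[OF Q(1)] by (auto simp: P_def)
  next
    fix x y assume x: "x \<in> P" "x \<unlhd> y"
    obtain s n where s: "s \<in> S" "s * x ^ n \<in> Q" using meets x by blast
    have "s * x ^ n \<unlhd> s * y ^ n" using x by (intro divides_mult divides_power) auto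
    then have "s * y ^ n \<in> Q" using s Q gcd_idealD(2) by blast
    then have "y \<notin> S" using S(3)[OF s(1) S_power[of y n]] S(4) by blast
    then show "y \<in> P" using x divides_in_R by (auto simp: P_def)
  next
    fix x y d assume xy: "x \<in> P" "y \<in> P" and d: "is_gcd d x y"
    obtain s m where s: "s \<in> S" "s * x ^ m \<in> Q" using meets xy by blast
    obtain t n where t: "t \<in> S" "t * y ^ n \<in> Q" using meets xy by blast
    have R: "x \<in> R" "y \<in> R" "s \<in> R" "t \<in> R" using xy s t S(1) by (auto simp: P_def)
    have "s * x ^ m * (t * x ^ n) \<in> Q" "t * y ^ n * (s * y ^ m) \<in> Q"
      using s t R Q(1) by (auto intro!: gcd_ideal_mult mult_in power_in)
    then have "s * t * x ^ (m + n) \<in> Q" "s * t * y ^ (m + n) \<in> Q"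
      by (simp_all add: power_add mult_ac)
    moreover have "is_gcd (s * t * d ^ (m + n)) (s * t * x ^ (m + n)) (s * t * y ^ (m + n))"
      by (intro is_gcd_scale is_gcd_power d)
    ultimately have "s * t * d ^ (m + n) \<in> Q" using Q(1) gcd_idealD(3) by blast
    then have "d \<notin> S" using S(3)[OF S(3)[OF s(1) t(1)] S_power[of d "m + n"]] S(4) by blast
    then show "d \<in> P" using is_gcd_in_R[OF d] R by (simp add: P_def)
  qed
  have Q_P: "Q \<subseteq> P" using Q S(4) by (auto simp: P_def)
  have prime: "a \<in> P \<or> b \<in> P" if "a \<in> R" "b \<in> R" "a * b \<in> P" for a b
    using that S(3)[of a b] by (auto simp: P_def)
  have tP: "t_prime R P"
    using P prime Q Q_P S(2) by (intro t_primeI[of P q]) (auto simp: P_def)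
  have "\<exists>a\<in>P. a\<^sup>2 \<unlhd> x" if x: "x \<in> P" for x
  proof (cases "x = 0")
    case True
    then show ?thesis using x by (intro bexI[of _ 0]) auto
  next
    case False
    obtain s n where s: "s \<in> S" "s * x ^ n \<in> Q" using meets x by blast
    obtain a where a: "a \<in> Q" "a ^ (2 * n) \<unlhd> s * x ^ n"
      using power_divisor_exists[OF sq Q(2) s(2)] by blast
    \<comment> \<open>From here on \<open>x = d v\<close> and \<open>a\<^sup>2 = d u\<close>, and the aim is \<open>u \<notin> P\<close>, so that \<open>d \<in> P\<close>.\<close>
    obtain d u v where d: "d \<noteq> 0" "is_gcd d (a\<^sup>2) x" "a\<^sup>2 = d * u" "x = d * v" "is_gcd 1 u v"
      using gcd_split[of "a\<^sup>2" x] False by blast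
    have R: "s \<in> R" "x \<in> R" "a \<in> R" using s S(1) x a Q(2) by (auto simp: P_def)
    have dR: "d \<in> R" using is_gcd_in_R[OF d(2)] R power_in by blast
    have uR: "u \<in> R" using coprime_in_R[OF d(5)] by blast
    have "d ^ n * u ^ n \<unlhd> d ^ n * (v ^ n * s)"
      using a(2) unfolding power_mult d(3,4) by (simp add: power_mult_distrib mult_ac)
    then have "u ^ n \<unlhd> v ^ n * s" using d(1) by (simp add: divides_mult_cancel)
    then have "u ^ n \<unlhd> s" using coprime_divides[OF coprime_power[OF d(5)]] R by blast
    moreover have "n \<noteq> 0" using s S(4) by (cases n) auto
    ultimately have "u \<notin> P"
    proof (intro notI)
      assume u: "u \<in> P" "u ^ n \<unlhd> s" "n \<noteq> 0"
      have "u \<unlhd> u ^ n" using power_divides_power[OF uR, of 1 n] u by simp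
      then have "s \<in> P" using u P divides_trans gcd_idealD(2) by blast
      then show False using s by (simp add: P_def)
    qed
    have "a\<^sup>2 \<in> P"
      unfolding power2_eq_square using gcd_ideal_mult[OF P] a Q_P R by blast
    then have "d \<in> P" using prime[OF dR uR] \<open>u \<notin> P\<close> d(3) by simp
    have "u \<noteq> 0" using \<open>u \<notin> P\<close> gcd_idealD(1)[OF P] by blast
    \<comment> \<open>The square \<open>a'\<^sup>2\<close> divides \<open>d\<close>, because \<open>g a'\<^sup>2 = d u'\<close> with \<open>a'\<close> and \<open>u'\<close> coprime.\<close>
    then obtain g a' u' where g: "g \<noteq> 0" "is_gcd g a u" "a = g * a'" "u = g * u'" "is_gcd 1 a' u'"
      using gcd_split[of a u] by blast
    have "g * (g * a'\<^sup>2) = g * (d * u')"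
      using d(3) unfolding g(3,4) by (simp add: power2_eq_square mult_ac)
    then have "g * a'\<^sup>2 = d * u'" using g(1) by simp
    then have "a'\<^sup>2 \<unlhd> u' * d"
      using is_gcd_in_R[OF g(2)] R uR divides_mult_right[of "a'\<^sup>2" "a'\<^sup>2" g] by (simp add: mult.commute)
    then have "a'\<^sup>2 \<unlhd> d"
      using coprime_divides[OF coprime_power[OF g(5), of 2 1]] dR by simp
    then have "a'\<^sup>2 \<unlhd> x" using is_gcdD(2)[OF d(2)] divides_trans by blast
    moreover have "a' \<in> P"
    proof -
      have "g \<notin> P" using is_gcdD(2)[OF g(2)] \<open>u \<notin> P\<close> P gcd_idealD(2) by blast
      moreover have "g * a' \<in> P" using a Q_P g(3) by auto
      ultimately show ?thesis
        using prime[of g a'] is_gcd_in_R[OF g(2)] R uR coprime_in_R[OF g(5)] by blast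
    qed
    ultimately show ?thesis by blast
  qed
  with tP show ?thesis by blast
qed

text \<open>
  \<open>J\<close> need not be integral, so the prime is sought over \<open>J \<inter> R\<close>.  This intersection inherits square
  divisors: if \<open>a\<^sup>2\<close> divides an integral element and \<open>a = b / h\<close> in lowest terms, then \<open>b\<^sup>2\<close> divides it
  too, and \<open>b = a h\<close> lies in \<open>J\<close>.
\<close>

lemma t_idempotent_contains_one:
  assumes disc: "strongly_t_discrete R" and J: "gcd_ideal J" "x \<in> J" "x \<noteq> 0"
    and sq: "\<forall>x\<in>J. \<exists>a\<in>J. a\<^sup>2 \<unlhd> x"
  shows "1 \<in> J"
proof (rule ccontr)
  assume "1 \<notin> J"
  define Q where "Q = J \<inter> R"
  have Q: "gcd_ideal Q" unfolding Q_def by (intro gcd_ideal_Int J gcd_ideal_R)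
  obtain p q where pq: "p \<in> R" "q \<in> R" "q \<noteq> 0" "x = p / q" by (rule fraction_cases)
  have "x * q \<in> J" using J pq gcd_ideal_mult by blast
  then have p: "p \<in> Q" "p \<noteq> 0" using pq J by (auto simp: Q_def)
  have "\<exists>b\<in>Q. b\<^sup>2 \<unlhd> y" if y: "y \<in> Q" for y
  proof -
    obtain a where a: "a \<in> J" "a\<^sup>2 \<unlhd> y" using sq y by (auto simp: Q_def)
    obtain g b h where g: "g \<noteq> 0" "a = g * b" "1 = g * h" "is_gcd 1 b h"
      using gcd_split[of a 1] by (metis zero_neq_one)
    have R: "b \<in> R" "h \<in> R" "y \<in> R" using coprime_in_R[OF g(4)] y by (auto simp: Q_def)
    have "b = a * h" using g by (simp add: mult_ac)
    then have "b \<in> Q" using R a J gcd_ideal_mult by (auto simp: Q_def)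
    have "h\<^sup>2 * a\<^sup>2 \<unlhd> h\<^sup>2 * y" using a(2) by (intro divides_mult) auto
    then have "b\<^sup>2 \<unlhd> h\<^sup>2 * y" using \<open>b = a * h\<close> by (simp add: power_mult_distrib mult.commute)
    then have "b\<^sup>2 \<unlhd> y" using coprime_divides[OF coprime_power[OF g(4)]] R by blast
    with \<open>b \<in> Q\<close> show ?thesis by blast
  qed
  then obtain P where "t_prime R P" "\<forall>x\<in>P. \<exists>a\<in>P. a\<^sup>2 \<unlhd> x"
    using square_divisible_t_prime_exists[OF Q _ _ p] \<open>1 \<notin> J\<close> unfolding Q_def by blast
  then show False using strongly_t_discreteD[OF disc] by blast
qed

text \<open>
  If \<open>(I\<^sup>2)\<^sub>t = c I\<close>, then \<open>J = c\<^sup>-\<^sup>1 I\<close> satisfies \<open>(J\<^sup>2)\<^sub>t = J\<close>; it contains \<open>1\<close>, so it is a ring and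
  \<open>I\<close> is \<open>c\<close> times this ring.
\<close>

lemma boole_imp_strongly_t_stable:
  assumes disc: "strongly_t_discrete R" and boole: "boole_t_regular R"
  shows "strongly_t_stable R"
  unfolding strongly_t_stable_def
proof (intro allI impI)
  fix I assume I: "t_ideal R I"
  obtain c where c: "c \<noteq> 0" "t_closure R (ideal_product R I I) = scaled c I"
    using boole I boole_t_regular_iff by blast
  obtain x0 where x0: "x0 \<in> I" "x0 \<noteq> 0" using I unfolding t_ideal_iff by blast
  have II: "x * y / c \<in> I" if "x \<in> I" "y \<in> I" for x y
  proof -
    have "x0 * x0 \<in> ideal_product R I I" using x0 by (intro ideal_product_mult)
    then have "ideal_product R I I \<noteq> {0}" using x0(2) by (metis mult_eq_0_iff singletonD)
    then have "x * y \<in> t_closure R (ideal_product R I I)"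
      using ideal_product_mult[OF that] subset_t_closure[OF submodule_ideal_product] by blast
    then show ?thesis using c by (simp add: scaled_iff)
  qed
  define J where "J = scaled (inverse c) I"
  have J_iff: "y \<in> J \<longleftrightarrow> c * y \<in> I" for y
    using c(1) by (simp add: J_def scaled_iff divide_inverse mult.commute)
  have "t_ideal R J" unfolding J_def using I c(1) by (intro t_ideal_scaled) auto
  then have "gcd_ideal J" by (rule t_ideal_gcd_ideal)
  moreover have "x0 / c \<in> J" "x0 / c \<noteq> 0" using x0 c(1) by (auto simp: J_iff)
  moreover have "\<forall>y\<in>J. \<exists>a\<in>J. a\<^sup>2 \<unlhd> y"
  proof
    fix y assume "y \<in> J"
    then have "c * (c * y) \<in> t_closure R (ideal_product R I I)" using c by (simp add: J_iff scaled_iff)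
    then obtain a where a: "a \<in> I" "a\<^sup>2 \<unlhd> c * (c * y)"
      using t_closure_square[OF t_ideal_gcd_ideal[OF I]] by blast
    have "c\<^sup>2 * (a / c)\<^sup>2 \<unlhd> c\<^sup>2 * y" using a c(1) by (simp add: power_divide power2_eq_square mult_ac)
    then have "(a / c)\<^sup>2 \<unlhd> y" using c(1) divides_mult_cancel[of "c\<^sup>2"] by simp
    then show "\<exists>a\<in>J. a\<^sup>2 \<unlhd> y" using a c(1) by (intro bexI[of _ "a / c"]) (auto simp: J_iff)
  qed
  ultimately have "1 \<in> J" by (rule t_idempotent_contains_one[OF disc])
  then have "c \<in> I" by (simp add: J_iff)
  moreover have "I = scaled c (colon I I)"
    using \<open>c \<in> I\<close> c(1) II by (rule strongly_t_stable_witness)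
  ultimately show "\<exists>c\<in>I. I = scaled c (colon I I)" by blast
qed

section \<open>Maximal \<open>t\<close>-ideals\<close>

lemma t_maximalD:
  assumes "t_maximal R M"
  shows "gcd_ideal M" "M \<subseteq> R" "1 \<notin> M" "x \<in> M \<Longrightarrow> x \<in> R"
proof -
  show "gcd_ideal M" "M \<subseteq> R" "x \<in> M \<Longrightarrow> x \<in> R"
    using assms t_ideal_gcd_ideal by (auto simp: t_maximal_def)
  then show "1 \<notin> M" using assms gcd_ideal_proper_iff by (auto simp: t_maximal_def)
qed

lemma t_maximal_maximal:
  assumes "t_maximal R M" "gcd_ideal N" "N \<subseteq> R" "1 \<notin> N" "M \<subseteq> N"
  shows "N = M"
proof -
  have "\<exists>x\<in>M. x \<noteq> 0" using assms(1) unfolding t_maximal_def t_ideal_iff by blast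
  then have "t_ideal R N \<and> N \<subseteq> R" unfolding integral_t_ideal_iff using assms by blast
  moreover have "N \<subset> R" using assms gcd_ideal_proper_iff by blast
  ultimately show ?thesis using assms(1,5) unfolding t_maximal_def by blast
qed

lemma t_maximal_exists:
  assumes I: "gcd_ideal I" "I \<subseteq> R" "1 \<notin> I" "x \<in> I" "x \<noteq> 0"
  shows "\<exists>M. t_maximal R M \<and> I \<subseteq> M"
proof -
  define \<A> where "\<A> = {N. gcd_ideal N \<and> N \<subseteq> R \<and> 1 \<notin> N \<and> I \<subseteq> N}"
  have "\<exists>M\<in>\<A>. \<forall>N\<in>\<A>. M \<subseteq> N \<longrightarrow> N = M"
  proof (rule subset_Zorn_nonempty)
    show "\<A> \<noteq> {}" using I by (auto simp: \<A>_def)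
    fix C assume C: "C \<noteq> {}" "subset.chain \<A> C"
    have ch: "X \<subseteq> Y \<or> Y \<subseteq> X" if "X \<in> C" "Y \<in> C" for X Y
      using C(2) that unfolding subset.chain_def by blast
    have sub: "gcd_ideal X \<and> X \<subseteq> R \<and> 1 \<notin> X \<and> I \<subseteq> X" if "X \<in> C" for X
      using C(2) that unfolding subset.chain_def \<A>_def by blast
    have "gcd_ideal (\<Union>C)" using C(1) sub ch by (intro gcd_ideal_Union_chain) auto
    then show "\<Union>C \<in> \<A>" using C(1) sub unfolding \<A>_def by blast
  qed
  then obtain M where "M \<in> \<A>" and max: "\<And>N. N \<in> \<A> \<Longrightarrow> M \<subseteq> N \<Longrightarrow> N = M" by blast
  then have M: "gcd_ideal M" "M \<subseteq> R" "1 \<notin> M" "I \<subseteq> M" by (auto simp: \<A>_def)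
  have "x \<in> M" using M I by blast
  then have tM: "t_ideal R M" using integral_t_ideal_iff[of M] M I(5) by blast
  have "N = M" if N: "t_ideal R N" "N \<subset> R" "M \<subseteq> N" for N
  proof -
    have "gcd_ideal N" using N t_ideal_gcd_ideal by blast
    moreover have "1 \<notin> N" using calculation N gcd_ideal_proper_iff by blast
    ultimately show ?thesis using N M by (intro max) (auto simp: \<A>_def)
  qed
  then have "t_maximal R M"
    using tM M gcd_ideal_proper_iff unfolding t_maximal_def by blast
  with M show ?thesis by blast
qed

text \<open>
  The multiples of the gcds of \<open>x\<close> with the elements of \<open>M\<close> form a gcd-closed ideal that properly contains
  \<open>M\<close>, so it contains \<open>1\<close>.
\<close>

lemma t_maximal_coprime:
  assumes M: "t_maximal R M" and x: "x \<in> R" "x \<notin> M"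
  shows "\<exists>m\<in>M. is_gcd 1 x m"
proof -
  note MD = t_maximalD[OF M]
  define N where "N = {y. \<exists>m\<in>M. \<exists>g. is_gcd g x m \<and> g \<unlhd> y}"
  have N: "gcd_ideal N"
    unfolding gcd_ideal_def
  proof (intro conjI ballI allI impI)
    obtain g where "is_gcd g x 0" using gcd_exists by blast
    then show "0 \<in> N" using gcd_idealD(1)[OF MD(1)] divides_zero unfolding N_def by blast
  next
    fix y z assume "y \<in> N" "y \<unlhd> z"
    then show "z \<in> N" unfolding N_def using divides_trans by blast
  next
    fix y z d assume "y \<in> N" "z \<in> N" and d: "is_gcd d y z"
    then obtain m n g h where m: "m \<in> M" "is_gcd g x m" "g \<unlhd> y"
      and n: "n \<in> M" "is_gcd h x n" "h \<unlhd> z" unfolding N_def by blast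
    obtain k where k: "is_gcd k m n" using gcd_exists by blast
    obtain e where e: "is_gcd e x k" using gcd_exists by blast
    have "e \<unlhd> g" using is_gcdD(1,2)[OF e] is_gcdD(1)[OF k] is_gcdD(3)[OF m(2)] divides_trans by blast
    moreover have "e \<unlhd> h"
      using is_gcdD(1,2)[OF e] is_gcdD(2)[OF k] is_gcdD(3)[OF n(2)] divides_trans by blast
    ultimately have "e \<unlhd> d" using is_gcdD(3)[OF d] m n divides_trans by blast
    moreover have "k \<in> M" using MD(1) m n k gcd_idealD(3) by blast
    ultimately show "d \<in> N" unfolding N_def using e by blast
  qed
  have "M \<subseteq> N"
  proof
    fix m assume m: "m \<in> M"
    obtain g where g: "is_gcd g x m" using gcd_exists by blast
    with m is_gcdD(2)[OF g] show "m \<in> N" unfolding N_def by blast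
  qed
  moreover have "x \<in> N"
  proof -
    obtain m where m: "m \<in> M" using gcd_idealD(1)[OF MD(1)] by blast
    obtain g where g: "is_gcd g x m" using gcd_exists by blast
    with m is_gcdD(1)[OF g] show ?thesis unfolding N_def by blast
  qed
  moreover have "N \<subseteq> R"
  proof
    fix y assume "y \<in> N"
    then obtain m g where "m \<in> M" "is_gcd g x m" "g \<unlhd> y" unfolding N_def by blast
    then show "y \<in> R" using is_gcd_in_R x MD(4) divides_in_R by blast
  qed
  ultimately have "1 \<in> N" using t_maximal_maximal[OF M N] x(2) by blast
  then obtain m g where m: "m \<in> M" "is_gcd g x m" "g \<unlhd> 1" unfolding N_def by blast
  have "is_gcd 1 x m"
  proof (rule is_gcdI)
    show "1 \<unlhd> x" "1 \<unlhd> m" using x m MD(4) by auto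
    show "e \<unlhd> 1" if "e \<unlhd> x" "e \<unlhd> m" for e
      using is_gcdD(3)[OF m(2) that] m(3) divides_trans by blast
  qed
  with m show ?thesis by blast
qed

lemma t_maximal_coprime_notin:
  assumes "t_maximal R M" "is_gcd 1 x y" "x \<in> M"
  shows "y \<notin> M"
  using assms t_maximalD(1,3)[OF assms(1)] gcd_idealD(3) by blast

text \<open>
  Maximal \<open>t\<close>-ideals are prime: an element of \<open>M\<close> coprime to both \<open>x\<close> and \<open>y\<close> is coprime to \<open>x * y\<close>.
\<close>

lemma t_maximal_mult_notin:
  assumes M: "t_maximal R M" and x: "x \<in> R" "x \<notin> M" and y: "y \<in> R" "y \<notin> M"
  shows "x * y \<notin> M"
proof -
  obtain m where m: "m \<in> M" "is_gcd 1 x m" using t_maximal_coprime[OF M x] by blast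
  obtain n where n: "n \<in> M" "is_gcd 1 y n" using t_maximal_coprime[OF M y] by blast
  obtain k where k: "is_gcd k m n" using gcd_exists by blast
  have kM: "k \<in> M" using k m n t_maximalD(1)[OF M] gcd_idealD(3) by blast
  then have "k \<in> R" using t_maximalD(4)[OF M] by blast
  then have "is_gcd 1 x k" "is_gcd 1 y k"
    using coprime_divisor[OF m(2) is_gcdD(1)[OF k]] coprime_divisor[OF n(2) is_gcdD(2)[OF k]] by auto
  then have "is_gcd 1 k (x * y)" using coprime_mult is_gcd_commute by blast
  then show ?thesis using t_maximal_coprime_notin[OF M _ kM] by blast
qed

section \<open>Stability implies finite \<open>t\<close>-character\<close>

lemma finite_t_character_iff:
  "finite_t_character R \<longleftrightarrow> (\<forall>a\<in>R. a \<noteq> 0 \<longrightarrow> finite {M. t_maximal R M \<and> a \<in> M})"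
proof
  assume fin: "finite_t_character R"
  show "\<forall>a\<in>R. a \<noteq> 0 \<longrightarrow> finite {M. t_maximal R M \<and> a \<in> M}"
  proof (intro ballI impI)
    fix a assume a: "a \<in> R" "a \<noteq> 0"
    let ?I = "{x. a \<unlhd> x}"
    have sub: "?I \<subseteq> R" using a divides_in_R by blast
    have t: "t_ideal R ?I \<and> ?I \<subseteq> R"
      unfolding integral_t_ideal_iff using gcd_ideal_principal sub a divides_refl by blast
    have "{M. t_maximal R M \<and> a \<in> M} \<subseteq> {M. t_maximal R M \<and> ?I \<subseteq> M}"
      using t_maximalD(1) gcd_idealD(2) by blast
    moreover have "finite {M. t_maximal R M \<and> ?I \<subseteq> M}"
    proof (cases "?I \<subset> R")
      case True
      with fin t show ?thesis unfolding finite_t_character_def by blast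
    next
      case False
      then have "?I = R" using sub by blast
      then have none: "{M. t_maximal R M \<and> ?I \<subseteq> M} = {}" using t_maximalD(3) one_in by blast
      show ?thesis unfolding none by simp
    qed
    ultimately show "finite {M. t_maximal R M \<and> a \<in> M}" by (rule finite_subset)
  qed
next
  assume fin: "\<forall>a\<in>R. a \<noteq> 0 \<longrightarrow> finite {M. t_maximal R M \<and> a \<in> M}"
  show "finite_t_character R"
    unfolding finite_t_character_def
  proof (intro allI impI)
    fix I assume I: "t_ideal R I \<and> I \<subset> R"
    then obtain a where a: "a \<in> I" "a \<noteq> 0" unfolding t_ideal_iff by blast
    then have "finite {M. t_maximal R M \<and> a \<in> M}" using fin I by blast
    moreover have "{M. t_maximal R M \<and> I \<subseteq> M} \<subseteq> {M. t_maximal R M \<and> a \<in> M}" using a by blast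
    ultimately show "finite {M. t_maximal R M \<and> I \<subseteq> M}" by (rule finite_subset[rotated])
  qed
qed

text \<open>
  Take two \<open>t\<close>-maximal ideals \<open>M\<close>, \<open>N\<close> from the infinite family.  They contain coprime divisors
  \<open>x \<in> M\<close> and \<open>y \<in> N\<close> of \<open>a\<close>, which can be chosen coprime to \<open>p\<close>.  No member of the family contains
  both, so infinitely many members omit \<open>x\<close>, or infinitely many omit \<open>y\<close>; the omitted element is the
  new factor.
\<close>

lemma coprime_factor_step:
  assumes p: "p \<in> R" "p \<unlhd> a" and inf: "infinite {M. t_maximal R M \<and> a \<in> M \<and> p \<notin> M}"
  shows "\<exists>x. p * x \<unlhd> a \<and> is_gcd 1 p x \<and> \<not> x \<unlhd> 1 \<and>
    infinite {M. t_maximal R M \<and> a \<in> M \<and> p * x \<notin> M}"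
proof -
  let ?\<M> = "\<lambda>p. {M. t_maximal R M \<and> a \<in> M \<and> p \<notin> M}"
  obtain M where M: "M \<in> ?\<M> p" using inf by (metis ex_in_conv finite.emptyI)
  obtain N where N: "N \<in> ?\<M> p" "N \<noteq> M"
    using inf by (metis (no_types, lifting) finite.simps finite_subset insertCI subsetI)
  have tM: "t_maximal R M" "a \<in> M" "p \<notin> M" and tN: "t_maximal R N" "a \<in> N" "p \<notin> N"
    using M N by auto
  have "\<not> M \<subseteq> N"
    using t_maximal_maximal[OF tM(1) t_maximalD(1-3)[OF tN(1)]] N(2) by blast
  then obtain u where u: "u \<in> M" "u \<notin> N" by blast
  then have uR: "u \<in> R" using t_maximalD(4)[OF tM(1)] by blast
  obtain n where n: "n \<in> N" "is_gcd 1 u n" using t_maximal_coprime[OF tN(1) uR u(2)] by blast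
  obtain m' where m': "m' \<in> M" "is_gcd 1 p m'" using t_maximal_coprime[OF tM(1) p(1) tM(3)] by blast
  obtain n' where n': "n' \<in> N" "is_gcd 1 p n'" using t_maximal_coprime[OF tN(1) p(1) tN(3)] by blast
  have common: "\<exists>x\<in>L. x \<unlhd> a \<and> x \<unlhd> v \<and> x \<unlhd> w" if L: "t_maximal R L" "a \<in> L" "v \<in> L" "w \<in> L" for L v w
  proof -
    obtain g where g: "is_gcd g v w" using gcd_exists by blast
    obtain x where x: "is_gcd x a g" using gcd_exists by blast
    have "g \<in> L" using g L t_maximalD(1)[OF L(1)] gcd_idealD(3) by blast
    then have "x \<in> L" using x L t_maximalD(1)[OF L(1)] gcd_idealD(3) by blast
    then show ?thesis using is_gcdD(1,2)[OF x] is_gcdD(1,2)[OF g] divides_trans by blast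
  qed
  obtain x where x: "x \<in> M" "x \<unlhd> a" "x \<unlhd> u" "x \<unlhd> m'" using common[OF tM(1,2) u(1) m'(1)] by blast
  obtain y where y: "y \<in> N" "y \<unlhd> a" "y \<unlhd> n" "y \<unlhd> n'" using common[OF tN(1,2) n(1) n'(1)] by blast
  have xR: "x \<in> R" and yR: "y \<in> R" using x y t_maximalD(4) tM tN by blast+
  have xy: "is_gcd 1 x y"
    using coprime_divisor[OF coprime_divisor[OF n(2) y(3) yR, unfolded is_gcd_commute[of 1 u]] x(3) xR]
    by (simp add: is_gcd_commute)
  have result: ?thesis
    if L: "t_maximal R L" and x: "x \<in> L" "x \<unlhd> a" "x \<unlhd> m" "is_gcd 1 p m"
      and inf: "infinite {M \<in> ?\<M> p. x \<notin> M}" for L x m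
  proof -
    have xR: "x \<in> R" using x(1) t_maximalD(4)[OF L] by blast
    have px: "is_gcd 1 p x" using coprime_divisor[OF x(4,3) xR] .
    have "p * x \<unlhd> a"
    proof -
      obtain q where q: "q \<in> R" "a = p * q" using p(2) by (auto simp: divides_in_def)
      have "x \<unlhd> q" using px x(2) q coprime_divides is_gcd_commute by blast
      then show ?thesis unfolding q(2) by (intro divides_mult) auto
    qed
    moreover have "\<not> x \<unlhd> 1" using x(1) t_maximalD(1,3)[OF L] gcd_idealD(2) by blast
    moreover have "{M \<in> ?\<M> p. x \<notin> M} \<subseteq> ?\<M> (p * x)" using t_maximal_mult_notin p(1) xR by blast
    then have "infinite (?\<M> (p * x))" using inf finite_subset by blast
    ultimately show ?thesis using px by blast
  qed
  have "?\<M> p = {M \<in> ?\<M> p. x \<notin> M} \<union> {M \<in> ?\<M> p. y \<notin> M}"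
    using t_maximal_coprime_notin[OF _ xy] by blast
  then have "infinite {M \<in> ?\<M> p. x \<notin> M} \<or> infinite {M \<in> ?\<M> p. y \<notin> M}"
    using inf by (metis (no_types, lifting) finite_Un)
  then show ?thesis
    using result[OF tM(1) x(1,2,4) m'(2)] result[OF tN(1) y(1,2,4) n'(2)] by blast
qed

text \<open>
  The elements \<open>a / p n\<close> generate an increasing union \<open>I\<close> of principal ideals.  Suppose that \<open>c\<close> generates
  \<open>I\<close> over \<open>(I : I)\<close>, with \<open>a / p m\<close> dividing \<open>c\<close>, and let \<open>b = a / p (Suc m)\<close>.  Then \<open>b\<^sup>2 / c \<in> I\<close> is a
  multiple of some \<open>a / p K\<close>.  Clearing denominators, the nonunit \<open>x = p (Suc m) / p m\<close> divides the
  product \<open>q = p K / p (Suc m)\<close> of later factors, to which it is coprime.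
\<close>

lemma no_infinite_coprime_factorization:
  assumes stable: "strongly_t_stable R"
    and a: "a \<in> R" "a \<noteq> 0"
    and p: "\<And>n. p n \<in> R" "\<And>n. p n \<unlhd> a"
    and step: "\<And>n. \<exists>x. p (Suc n) = p n * x \<and> is_gcd 1 (p n) x \<and> \<not> x \<unlhd> 1"
  shows False
proof -
  have split: "\<exists>q. p k = p n * q \<and> is_gcd 1 (p n) q" if "n \<le> k" for n k
    using that
  proof (induction k rule: dec_induct)
    case base
    have "is_gcd 1 (p n) 1" using p(1) by (intro is_gcdI) auto
    then show ?case by (intro exI[of _ 1]) simp
  next
    case (step k)
    obtain q where q: "p k = p n * q" "is_gcd 1 (p n) q" using step.IH by blast
    obtain x where x: "p (Suc k) = p k * x" "is_gcd 1 (p k) x" using assms(6)[of k] by blast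
    have "p n \<unlhd> p k" using q coprime_in_R(2)[OF q(2)] by (auto simp: divides_in_def)
    then have "is_gcd 1 (p n) x" using coprime_divisor[of x "p k" "p n"] x(2) p(1) is_gcd_commute by blast
    then show ?case using q x coprime_mult by (intro exI[of _ "q * x"]) (simp add: mult_ac)
  qed
  have nz: "p n \<noteq> 0" for n using p(2)[of n] a(2) by auto
  have anti: "a / p k \<unlhd> a / p n" if nk: "n \<le> k" for n k
  proof -
    obtain q where q: "p k = p n * q" "is_gcd 1 (p n) q" using split[OF nk] by blast
    have "a / p n = a / p k * q" using q(1) nz[of k] nz[of n] by (simp add: field_simps)
    then show ?thesis using coprime_in_R(2)[OF q(2)] unfolding divides_in_def by blast
  qed
  define I where "I = \<Union> (range (\<lambda>n. {y. a / p n \<unlhd> y}))"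
  have I_iff: "y \<in> I \<longleftrightarrow> (\<exists>n. a / p n \<unlhd> y)" for y by (simp add: I_def)
  have gI: "gcd_ideal I"
    unfolding I_def
  proof (rule gcd_ideal_Union_chain)
    fix X Y assume "X \<in> range (\<lambda>n. {y. a / p n \<unlhd> y})" "Y \<in> range (\<lambda>n. {y. a / p n \<unlhd> y})"
    then obtain m n where X: "X = {y. a / p m \<unlhd> y}" and Y: "Y = {y. a / p n \<unlhd> y}" by blast
    show "X \<subseteq> Y \<or> Y \<subseteq> X"
      unfolding X Y using anti[of m n] anti[of n m] divides_trans by (metis Collect_mono nle_le)
  qed (use gcd_ideal_principal in auto)
  have memb: "a / p n \<in> I" for n using I_iff divides_refl by blast
  have "I \<subseteq> R"
  proof
    fix y assume "y \<in> I"
    then obtain n where n: "a / p n \<unlhd> y" using I_iff by blast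
    have "a / p n \<in> R" using p(2)[of n] nz divides_iff by blast
    then show "y \<in> R" using n divides_in_R by blast
  qed
  then have "t_ideal R I \<and> I \<subseteq> R"
    unfolding integral_t_ideal_iff using gI memb[of 0] a(2) nz[of 0] by (auto intro!: bexI[of _ "a / p 0"])
  then obtain c where c: "c \<in> I" "I = scaled c (colon I I)"
    using stable unfolding strongly_t_stable_def by blast
  obtain m where m: "a / p m \<unlhd> c" using c(1) I_iff by blast
  define b where "b = a / p (Suc m)"
  have "b \<in> scaled c (colon I I)" using memb[of "Suc m"] c(2) b_def by simp
  then obtain w where w: "w \<in> colon I I" "b = c * w" by (auto simp: scaled_def)
  have "b \<noteq> 0" using a(2) nz by (simp add: b_def)
  then have "c \<noteq> 0" using w by auto
  have "w * b \<in> I" using w(1) memb[of "Suc m"] unfolding colon_def b_def by blast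
  then obtain k where k: "a / p k \<unlhd> w * b" using I_iff by blast
  \<comment> \<open>An index beyond \<open>m\<close> is needed to express \<open>p K\<close> through \<open>p (Suc m)\<close>.\<close>
  define K where "K = max k (Suc m)"
  have K: "a / p K \<unlhd> w * b" using anti[of k K] k divides_trans[of "a / p K" "a / p k"] by (simp add: K_def)
  obtain q where q: "p K = p (Suc m) * q" "is_gcd 1 (p (Suc m)) q" using split[of "Suc m" K] by (auto simp: K_def)
  obtain x where x: "p (Suc m) = p m * x" "is_gcd 1 (p m) x" "\<not> x \<unlhd> 1" using step by blast
  have xq_nz: "x \<noteq> 0" "q \<noteq> 0" using nz[of K] q x by auto
  obtain r where r: "r \<in> R" "c = a / p m * r" using m by (auto simp: divides_in_def)
  obtain s where s: "s \<in> R" "w * b = a / p K * s" using K by (auto simp: divides_in_def)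
  have "b * b = c * (w * b)" using w(2) by simp
  also have "\<dots> = a / p m * r * (a / p K * s)" by (simp only: r(2) s(2))
  finally have "a / (p m * x) * (a / (p m * x)) = a / p m * r * (a / (p m * x * q) * s)"
    unfolding b_def x(1) q(1) .
  then have "q = x * (r * s)"
    using a(2) nz[of m] xq_nz by (simp add: field_simps)
  then have "x \<unlhd> q" using mult_in[OF r(1) s(1)] unfolding divides_in_def by blast
  moreover have "x \<unlhd> p (Suc m)" unfolding x(1) using divides_mult_right[of x x "p m"] p(1)
    by (simp add: mult.commute)
  ultimately show False using is_gcdD(3)[OF q(2)] x(3) by blast
qed

lemma strongly_t_stable_imp_finite_t_character:
  assumes "strongly_t_stable R"
  shows "finite_t_character R"
  unfolding finite_t_character_iff
proof (intro ballI impI)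
  fix a assume a: "a \<in> R" "a \<noteq> 0"
  let ?\<M> = "\<lambda>p. {M. t_maximal R M \<and> a \<in> M \<and> p \<notin> M}"
  show "finite {M. t_maximal R M \<and> a \<in> M}"
  proof (rule ccontr)
    assume inf: "infinite {M. t_maximal R M \<and> a \<in> M}"
    have "{M. t_maximal R M \<and> a \<in> M} = ?\<M> 1" using t_maximalD(3) by blast
    then have base: "1 \<in> R \<and> 1 \<unlhd> a \<and> infinite (?\<M> 1)" using inf a by simp
    have "\<exists>p. \<forall>n. (p n \<in> R \<and> p n \<unlhd> a \<and> infinite (?\<M> (p n))) \<and>
      (\<exists>x. p (Suc n) = p n * x \<and> is_gcd 1 (p n) x \<and> \<not> x \<unlhd> 1)"
    proof (rule dependent_nat_choice)
      show "\<exists>p. p \<in> R \<and> p \<unlhd> a \<and> infinite (?\<M> p)" using base by blast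
      fix p and n :: nat assume "p \<in> R \<and> p \<unlhd> a \<and> infinite (?\<M> p)"
      then obtain x where "p \<in> R" "p * x \<unlhd> a" "is_gcd 1 p x" "\<not> x \<unlhd> 1" "infinite (?\<M> (p * x))"
        using coprime_factor_step by blast
      moreover then have "p * x \<in> R" using coprime_in_R mult_in by blast
      ultimately show "\<exists>p'. (p' \<in> R \<and> p' \<unlhd> a \<and> infinite (?\<M> p')) \<and>
          (\<exists>x. p' = p * x \<and> is_gcd 1 p x \<and> \<not> x \<unlhd> 1)" by blast
    qed
    then obtain p where "\<And>n. p n \<in> R" "\<And>n. p n \<unlhd> a"
      "\<And>n. \<exists>x. p (Suc n) = p n * x \<and> is_gcd 1 (p n) x \<and> \<not> x \<unlhd> 1" by blast
    then show False by (rule no_infinite_coprime_factorization[OF assms a])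
  qed
qed

section \<open>Gluing local generators\<close>

text \<open>
  The conclusion says that \<open>y\<close> generates the localization of \<open>I\<close> at \<open>M\<close> over its endomorphism ring.  Let
  \<open>Z\<close> be the set of \<open>z \<in> R\<close> that do not act surjectively on this localization.  It is a \<open>t\<close>-prime
  inside \<open>M\<close>, and its localization is the maximal ideal of that endomorphism ring.  Discreteness
  yields \<open>z \<in> Z\<close> that is no multiple of a square of an element of \<open>Z\<close>, and such a \<open>z\<close> generates
  \<open>Z\<close> locally.  Any \<open>y \<in> I\<close> outside the localization of \<open>z I\<close> is then a generator: for \<open>x \<in> I\<close>, write
  \<open>x / y = x' / y'\<close> in lowest terms; \<open>y' \<in> Z\<close> would put \<open>y\<close> into \<open>z I\<close> locally, hence \<open>y' \<notin> Z\<close>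
  acts invertibly and \<open>x / y\<close> maps \<open>I\<close> into itself locally.
\<close>

lemma local_generator:
  assumes disc: "strongly_t_discrete R" and M: "t_maximal R M"
    and I: "gcd_ideal I" "I \<subseteq> M" "i0 \<in> I" "i0 \<noteq> 0"
  shows "\<exists>y\<in>I. y \<noteq> 0 \<and> (\<forall>x\<in>I. \<forall>i\<in>I. \<exists>s\<in>R - M. s * (x * i) / y \<in> I)"
proof -
  note MD = t_maximalD[OF M]
  have I_mult: "x * r \<in> I" "r * x \<in> I" if "x \<in> I" "r \<in> R" for x r
    using gcd_ideal_mult[OF I(1) that] by (simp_all add: mult.commute)
  have U_mult: "s * t \<in> R - M" if "s \<in> R - M" "t \<in> R - M" for s t
    using that t_maximal_mult_notin[OF M] mult_in by blast
  have one: "1 \<in> R - M" using MD(3) by simp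
  define Z where "Z = {z \<in> R. \<exists>y\<in>I. \<forall>s\<in>R - M. \<forall>w\<in>I. s * y \<noteq> z * w}"
  \<comment> \<open>An element outside \<open>Z\<close> acts surjectively on the localization of \<open>I\<close> at \<open>M\<close>.\<close>
  have absorb: "\<exists>s\<in>R - M. \<exists>w\<in>I. s * y = z * w" if "z \<in> R" "z \<notin> Z" "y \<in> I" for z y
    using that unfolding Z_def by blast
  have notin_Z: "z \<notin> Z" if "\<And>y. y \<in> I \<Longrightarrow> \<exists>s\<in>R - M. \<exists>w\<in>I. s * y = z * w" for z
    using that unfolding Z_def by blast
  have one_Z: "1 \<notin> Z"
    using one by (intro notin_Z) force
  have i0_Z: "i0 \<in> Z"
  proof -
    have "s * i0 \<noteq> i0 * w" if "s \<in> R - M" "w \<in> I" for s w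
      using that I by (metis DiffD2 mult.commute mult_cancel_left subsetD)
    then show ?thesis unfolding Z_def using I MD(2) by blast
  qed
  have prime: "a \<in> Z \<or> b \<in> Z" if ab: "a \<in> R" "b \<in> R" "a * b \<in> Z" for a b
  proof (rule ccontr)
    assume no: "\<not> (a \<in> Z \<or> b \<in> Z)"
    have "a * b \<notin> Z"
    proof (rule notin_Z)
      fix y assume y: "y \<in> I"
      obtain s w where s: "s \<in> R - M" "w \<in> I" "s * y = a * w" using absorb[of a y] ab no y by blast
      obtain t v where t: "t \<in> R - M" "v \<in> I" "t * w = b * v" using absorb[of b w] ab no s by blast
      have "t * s * y = a * (t * w)" using s(3) by (simp add: mult_ac)
      then have "t * s * y = a * b * v" using t(3) by (simp add: mult_ac)
      then show "\<exists>s\<in>R - M. \<exists>w\<in>I. s * y = a * b * w" using U_mult[OF t(1) s(1)] t(2) by blast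
    qed
    with ab show False by blast
  qed
  have Z: "gcd_ideal Z"
    unfolding gcd_ideal_def
  proof (intro conjI ballI allI impI)
    have "s * i0 \<noteq> 0 * w" if "s \<in> R - M" for s w
      using that gcd_idealD(1)[OF MD(1)] I(4) by auto
    then show "0 \<in> Z" unfolding Z_def using I(3) zero_in by blast
  next
    fix x x' assume x: "x \<in> Z" "x \<unlhd> x'"
    then obtain r where r: "r \<in> R" "x' = x * r" by (auto simp: divides_in_def)
    have "x \<in> R" using x by (simp add: Z_def)
    obtain y where y: "y \<in> I" "\<forall>s\<in>R - M. \<forall>w\<in>I. s * y \<noteq> x * w" using x unfolding Z_def by blast
    have "s * y \<noteq> x' * w" if "s \<in> R - M" "w \<in> I" for s w
      using y(2) that I_mult(2)[OF that(2) r(1)] unfolding r(2) by (simp add: mult.assoc)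
    then show "x' \<in> Z" unfolding Z_def using y(1) mult_in[OF \<open>x \<in> R\<close> r(1)] r(2) by blast
  next
    fix a b d assume ab: "a \<in> Z" "b \<in> Z" and d: "is_gcd d a b"
    show "d \<in> Z"
    proof (cases "d = 0")
      case True
      then have "a = 0" using is_gcdD(1)[OF d] by simp
      then show ?thesis using True ab by simp
    next
      case False
      have R: "a \<in> R" "b \<in> R" using ab by (simp_all add: Z_def)
      obtain a' b' where ab': "a = d * a'" "b = d * b'"
        using is_gcdD(1,2)[OF d] unfolding divides_in_def by blast
      have cop: "is_gcd 1 a' b'"
        using ab' False is_gcd_scale[OF d, of "inverse d"] by (simp flip: mult.assoc)
      have *: "d \<in> Z" if c: "c = d * c'" "c \<in> Z" "c' \<in> R - M" for c c'
      proof -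
        obtain y where y: "y \<in> I" "\<forall>s\<in>R - M. \<forall>w\<in>I. s * y \<noteq> c * w" using c(2) unfolding Z_def by blast
        have "s * y \<noteq> d * w" if sw: "s \<in> R - M" "w \<in> I" for s w
        proof
          assume "s * y = d * w"
          then have "c' * s * y = c * w" using c(1) by (simp add: mult_ac)
          with y(2) U_mult[OF c(3) sw(1)] sw(2) show False by blast
        qed
        then show ?thesis unfolding Z_def using y(1) is_gcd_in_R[OF d R] by blast
      qed
      have "a' \<in> R - M \<or> b' \<in> R - M"
        using coprime_in_R[OF cop] t_maximal_coprime_notin[OF M cop] by blast
      then show ?thesis using *[OF ab'(1) ab(1)] *[OF ab'(2) ab(2)] by blast
    qed
  qed
  have "Z \<subseteq> R" by (auto simp: Z_def)
  then have "t_prime R Z" using prime by (intro t_primeI[OF Z _ one_Z i0_Z I(4)])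
  then obtain z where z: "z \<in> Z" "\<forall>b\<in>Z. \<not> b\<^sup>2 \<unlhd> z" using strongly_t_discreteD[OF disc] by blast
  have "z \<noteq> 0" using z by (metis divides_zero)
  \<comment> \<open>If \<open>z' = z / gcd z w\<close> were in \<open>Z\<close>, the square of its gcd with \<open>d\<close> would divide \<open>z\<close>.\<close>
  have z_gen: "\<exists>s\<in>R - Z. z \<unlhd> s * w" if w: "w \<in> Z" for w
  proof -
    obtain d z' w' where d: "d \<noteq> 0" "is_gcd d z w" "z = d * z'" "w = d * w'" "is_gcd 1 z' w'"
      using gcd_split[of z w] \<open>z \<noteq> 0\<close> by blast
    have dZ: "d \<in> Z" using Z z w d(2) gcd_idealD(3) by blast
    have R: "z' \<in> R" "w' \<in> R" using coprime_in_R[OF d(5)] by auto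
    have "z' \<notin> Z"
    proof
      assume z'Z: "z' \<in> Z"
      obtain b where b: "is_gcd b d z'" using gcd_exists by blast
      have "b \<in> Z" using Z dZ z'Z b gcd_idealD(3) by blast
      moreover have "b\<^sup>2 \<unlhd> z"
        unfolding d(3) power2_eq_square using is_gcdD(1,2)[OF b] by (intro divides_mult)
      ultimately show False using z(2) by blast
    qed
    moreover have "z \<unlhd> z' * w"
    proof -
      have "z' * w = z * w'" unfolding d(3,4) by (simp only: mult_ac)
      then show ?thesis using R(2) unfolding divides_in_def by blast
    qed
    ultimately show ?thesis using R by blast
  qed
  obtain y where y: "y \<in> I" "\<And>s w. s \<in> R - M \<Longrightarrow> w \<in> I \<Longrightarrow> s * y \<noteq> z * w"
    using z(1) unfolding Z_def by blast
  have "y \<noteq> 0" using y(2)[OF one gcd_idealD(1)[OF I(1)]] by auto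
  have "\<exists>s\<in>R - M. s * (x * i) / y \<in> I" if x: "x \<in> I" and i: "i \<in> I" for x i
  proof -
    obtain d x' y' where d: "d \<noteq> 0" "is_gcd d x y" "x = d * x'" "y = d * y'" "is_gcd 1 x' y'"
      using gcd_split[of x y] \<open>y \<noteq> 0\<close> by blast
    have dI: "d \<in> I" using I(1) x y(1) d(2) gcd_idealD(3) by blast
    have R: "x' \<in> R" "y' \<in> R" using coprime_in_R[OF d(5)] by auto
    have "y' \<notin> Z"
    proof
      assume "y' \<in> Z"
      then obtain s where s: "s \<in> R - Z" "z \<unlhd> s * y'" using z_gen by blast
      then obtain r where r: "r \<in> R" "s * y' = z * r" by (auto simp: divides_in_def)
      obtain t d' where t: "t \<in> R - M" "d' \<in> I" "t * d = s * d'" using absorb[of s d] s dI by blast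
      have "t * y = (t * d) * y'" using d(4) by (simp add: mult_ac)
      also have "\<dots> = (s * y') * d'" using t(3) by (simp add: mult_ac)
      also have "\<dots> = z * (r * d')" using r(2) by (simp add: mult_ac)
      finally show False using y(2)[OF t(1) I_mult(2)[OF t(2) r(1)]] by blast
    qed
    then obtain t i' where t: "t \<in> R - M" "i' \<in> I" "t * i = y' * i'" using absorb[of y' i] R i by blast
    have "t * (x * i) = x * (t * i)" by (simp only: mult_ac)
    also have "\<dots> = y * (x' * i')" unfolding t(3) d(3,4) by (simp only: mult_ac)
    finally have "t * (x * i) / y = x' * i'" using \<open>y \<noteq> 0\<close> by simp
    then show ?thesis using I_mult(2)[OF t(2) R(1)] by (intro bexI[OF _ t(1)]) simp
  qed
  with y(1) \<open>y \<noteq> 0\<close> show ?thesis by blast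
qed

text \<open>
  Start from \<open>i0 \<in> I\<close>, which already generates \<open>I\<close> locally at every \<open>t\<close>-maximal ideal that does not contain
  \<open>i0\<close>.  The remaining ones are finite in number; pick a local generator \<open>f M\<close> for each of them.  The
  gcd \<open>c\<close> of all these elements is a generator at every \<open>t\<close>-maximal ideal, so for
  \<open>x\<close>, \<open>y\<close> in \<open>I\<close> the ideal of all \<open>r \<in> R\<close> with \<open>r x y / c \<in> I\<close> lies in no \<open>t\<close>-maximal ideal.
\<close>

lemma integral_generator:
  assumes disc: "strongly_t_discrete R" and fin: "finite_t_character R"
    and I: "gcd_ideal I" "I \<subseteq> R" "i0 \<in> I" "i0 \<noteq> 0"
  shows "\<exists>c\<in>I. c \<noteq> 0 \<and> (\<forall>x\<in>I. \<forall>y\<in>I. x * y / c \<in> I)"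
proof -
  have I_mult: "x * r \<in> I" if "x \<in> I" "r \<in> R" for x r
    by (rule gcd_ideal_mult[OF I(1) that])
  define good where "good c M \<longleftrightarrow> (\<forall>x\<in>I. \<forall>i\<in>I. \<exists>s\<in>R - M. s * (x * i) / c \<in> I)" for c M
  have good_divisor: "good c M" if y: "good y M" "c \<unlhd> y" "y \<noteq> 0" for c y M
    unfolding good_def
  proof (intro ballI)
    fix x i assume "x \<in> I" "i \<in> I"
    then obtain s where s: "s \<in> R - M" "s * (x * i) / y \<in> I" using y(1) unfolding good_def by blast
    obtain r where r: "r \<in> R" "y = c * r" using y(2) by (auto simp: divides_in_def)
    have "s * (x * i) / c = s * (x * i) / y * r" using r(2) y(3) by simp
    then show "\<exists>s\<in>R - M. s * (x * i) / c \<in> I" using s I_mult[OF s(2) r(1)] by (intro bexI[of _ s]) simp_all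
  qed
  have good_outside: "good y M" if "y \<in> I" "y \<notin> M" "y \<noteq> 0" for y M
    unfolding good_def
  proof (intro ballI)
    fix x i assume "x \<in> I" "i \<in> I"
    then have "y * (x * i) / y \<in> I" using that(3) I_mult I(2) by auto
    then show "\<exists>s\<in>R - M. s * (x * i) / y \<in> I" using that I(2) by blast
  qed
  have good_exists: "\<exists>y\<in>I. y \<noteq> 0 \<and> good y M" if M: "t_maximal R M" for M
  proof (cases "I \<subseteq> M")
    case True
    then show ?thesis using local_generator[OF disc M I(1) _ I(3,4)] unfolding good_def by blast
  next
    case False
    then obtain y where y: "y \<in> I" "y \<notin> M" by blast
    then have "y \<noteq> 0" using gcd_idealD(1)[OF t_maximalD(1)[OF M]] by blast
    then show ?thesis using y good_outside by blast
  qed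
  then obtain f where f: "\<And>M. t_maximal R M \<Longrightarrow> f M \<in> I \<and> f M \<noteq> 0 \<and> good (f M) M" by metis
  define F where "F = {M. t_maximal R M \<and> i0 \<in> M}"
  have "finite F" unfolding F_def using fin I finite_t_character_iff by blast
  then have "finite (insert i0 (f ` F))" by simp
  from finite_gcd_exists[OF this] obtain c
    where c: "\<forall>e. (\<forall>s\<in>insert i0 (f ` F). e \<unlhd> s) \<longleftrightarrow> e \<unlhd> c"
      and cI: "\<forall>J. gcd_ideal J \<longrightarrow> insert i0 (f ` F) \<subseteq> J \<longrightarrow> c \<in> J" by blast
  have "c \<in> I" using cI I(1,3) f unfolding F_def by blast
  have dv: "c \<unlhd> s" if "s \<in> insert i0 (f ` F)" for s using c that divides_refl by blast
  have "c \<noteq> 0" using dv[of i0] I(4) by auto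
  have good: "good c M" if M: "t_maximal R M" for M
  proof (cases "i0 \<in> M")
    case True
    then have "M \<in> F" using M by (simp add: F_def)
    then show ?thesis using good_divisor[of "f M" M c] f[OF M] dv by blast
  next
    case False
    then show ?thesis using good_divisor[OF good_outside[OF I(3) False I(4)]] dv I(4) by blast
  qed
  have "x * y / c \<in> I" if xy: "x \<in> I" "y \<in> I" for x y
  proof -
    \<comment> \<open>\<open>A\<close> is the ideal of denominators of \<open>x y / c\<close>; it is nonzero as it contains \<open>c\<close>.\<close>
    define A where "A = {r. r * (x * y / c) \<in> I} \<inter> R"
    have A: "gcd_ideal A" "A \<subseteq> R"
      unfolding A_def by (intro gcd_ideal_Int gcd_ideal_quotient gcd_ideal_R I) blast
    have cA: "c \<in> A" using I_mult[OF xy(1), of y] xy \<open>c \<in> I\<close> \<open>c \<noteq> 0\<close> I(2) by (auto simp: A_def)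
    have "1 \<in> A"
    proof (rule ccontr)
      assume "1 \<notin> A"
      then obtain M where M: "t_maximal R M" "A \<subseteq> M"
        using t_maximal_exists[OF A _ cA \<open>c \<noteq> 0\<close>] by blast
      obtain s where s: "s \<in> R - M" "s * (x * y) / c \<in> I"
        using good[OF M(1)] xy unfolding good_def by blast
      then have "s \<in> A" by (simp add: A_def)
      with s M show False by blast
    qed
    then show ?thesis by (simp add: A_def)
  qed
  with \<open>c \<in> I\<close> \<open>c \<noteq> 0\<close> show ?thesis by blast
qed

text \<open>
  Multiplication by a common denominator \<open>d\<close> reduces to integral ideals, the endomorphism ring being
  unchanged.
\<close>

lemma finite_t_character_imp_strongly_t_stable:
  assumes disc: "strongly_t_discrete R" and fin: "finite_t_character R"
  shows "strongly_t_stable R"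
  unfolding strongly_t_stable_def
proof (intro allI impI)
  fix I assume I: "t_ideal R I"
  then obtain x d where x: "x \<in> I" "x \<noteq> 0" and d: "d \<in> R" "d \<noteq> 0" "\<forall>y\<in>I. d * y \<in> R"
    unfolding t_ideal_iff by blast
  have J: "gcd_ideal (scaled d I)" using t_ideal_scaled[OF I d(2)] by (rule t_ideal_gcd_ideal)
  have "scaled d I \<subseteq> R" "d * x \<in> scaled d I" "d * x \<noteq> 0" using d x by (auto simp: scaled_def)
  from integral_generator[OF disc fin J this]
  obtain c where c: "c \<in> scaled d I" "c \<noteq> 0"
    "\<forall>x\<in>scaled d I. \<forall>y\<in>scaled d I. x * y / c \<in> scaled d I" by blast
  then obtain c0 where c0: "c0 \<in> I" "c = d * c0" by (auto simp: scaled_def)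
  have "x * y / c0 \<in> I" if "x \<in> I" "y \<in> I" for x y
  proof -
    have "d * x * (d * y) / c \<in> scaled d I" using c(3) that by (auto simp: scaled_def)
    then show ?thesis using c0 d(2) by (simp add: scaled_iff)
  qed
  then have "I = scaled c0 (colon I I)" using c0 c(2) by (intro strongly_t_stable_witness) auto
  then show "\<exists>c\<in>I. I = scaled c (colon I I)" using c0(1) by blast
qed

end

section \<open>The equivalence\<close>

theorem theorem2p11:
  fixes R :: "'k::field set"
  assumes "domain_with_quotient_field R"
    and "v_domain R"
  shows "(strongly_t_discrete R \<and> boole_t_regular R \<longleftrightarrow>
            strongly_t_discrete R \<and> gcd_domain R \<and> finite_t_character R) \<and>
         (strongly_t_discrete R \<and> gcd_domain R \<and> finite_t_character R \<longleftrightarrow>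
            strongly_t_stable R)"
proof -
  interpret quotient_field_domain R by unfold_locales (rule assms(1))
  have stable_if_boole: "strongly_t_stable R" if "strongly_t_discrete R" "boole_t_regular R"
  proof -
    interpret gcd_quotient_field_domain R
      by unfold_locales (rule boole_t_regular_imp_gcd_domain[OF assms(2) that(2)])
    show ?thesis using that by (rule boole_imp_strongly_t_stable)
  qed
  have gcd_finite_if_stable: "strongly_t_discrete R \<and> gcd_domain R \<and> finite_t_character R"
    if "strongly_t_stable R"
  proof -
    interpret gcd_quotient_field_domain R
      by unfold_locales (rule strongly_t_stable_imp_gcd_domain[OF assms(2) that])
    show ?thesis
      using that gcd strongly_t_stable_imp_discrete strongly_t_stable_imp_finite_t_character by blast
  qed
  have stable_if_gcd_finite: "strongly_t_stable R"
    if "strongly_t_discrete R" "gcd_domain R" "finite_t_character R"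
  proof -
    interpret gcd_quotient_field_domain R by unfold_locales (rule that(2))
    show ?thesis using that(1,3) by (rule finite_t_character_imp_strongly_t_stable)
  qed
  show ?thesis
    using stable_if_boole gcd_finite_if_stable stable_if_gcd_finite strongly_t_stable_imp_discrete strongly_t_stable_imp_boole
    by blast
qed

end
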